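(* Let $(\mathbf{X},Y),(\mathbf{X}_1,Y_1),(\mathbf{X}_2,Y_2),\dots$ be i.i.d. random pairs with values in $[0,1]^p\times\mathbb{R}$ satisfying $Y=m(\mathbf{X})+\epsilon$, where $m:\mathbb{R}^p\to\mathbb{R}$ is measurable, $\mathbb{E}[|m(\mathbf{X})|^2]<\infty$, $\epsilon$ is independent of $\mathbf{X}$, $\mathbb{E}[\epsilon]=0$ and $\mathrm{Var}(\epsilon)=\sigma^2<\infty$. Put $\mathcal{D}_n=\{(\mathbf{X}_i,Y_i):i=1,\dots,n\}$. Let $m_n(\cdot)=m_n(\cdot;\mathcal{D}_n)$ be the infinite random forest estimate defined in the context and assume that it is $L_2$-consistent, i.e. $$\lim_{n\to\infty}\mathbb{E}\big[(m_n(\mathbf{X})-m(\mathbf{X}))^2\big]=0,$$ where $(\mathbf{X},Y)$ is independent of $\mathcal{D}_n$ and the expectation is over $\mathbf{X}$ and $\mathcal{D}_n$. For $i=1,\dots,n$ let $\hat\epsilon_i=Y_i-m_n^{OOB}(\mathbf{X}_i)$, where $m_n^{OOB}(\mathbf{X}_i)$ is the out-of-bag prediction defined in the context, let $\bar\epsilon_\cdot=\frac1n\sum_{i=1}^n\hat\epsilon_i$, and $$\hat\sigma_{RF}^2=\frac1n\sum_{i=1}^n(\hat\epsilon_i-\bar\epsilon_\cdot)^2 .$$ Then $\hat\sigma_{RF}^2$ is asymptotically unbiased and $L_1$-consistent for $\sigma^2$: as $n\to\infty$, $\mathbb{E}[\hat\sigma_{RF}^2]\to\sigma^2$ and $\m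athbb{E}\big[|\hat\sigma_{RF}^2-\sigma^2|\big]\to0$.
   Context: Random forest. Parameters: $m_{try}\in\{1,\dots,p\}$; for each $n$, $a_n\in\{1,\dots,n\}$ (number of sampled points) and $t_n\in\{1,\dots,a_n\}$ (number of leaves); and a resampling strategy $\mathcal{S}$ (uniform sampling with or without replacement). Given a data set $\mathcal{D}_n$ of $n$ pairs, a random tree is built as follows; all of its auxiliary randomness (resampling and choice of split directions) is encoded in a random variable $\Theta$ independent of the data. (1) Draw $a_n$ data points from $\mathcal{D}_n$ according to $\mathcal{S}$; below, "points" means these selected points, counted with multiplicity. (2) Start with the single cell $[0,1]^p$ and cut cells level by level. To cut a cell $A$, choose uniformly without replacement a set $\mathcal{M}_{try}\subseteq\{1,\dots,p\}$ of $m_{try}$ directions, and among all cuts $(j,z)$ with $j\in\mathcal{M}_{try}$, $z\in[0,1]$, for which both $A_L=\{\mathbf{x}\in A:x_j<z\}$ and $A_R=\{\mathbf{x}\in A:x_j\ge z\}$ contain at least one point, choose one (ties broken by a fixed measurable rule) maximizing the empirical variance decrease $$L_n(j,z)=\frac{1}{N_n(A)}\sum_{i:\mathbf{X}_i\in A}(Y_i-\bar Y_A)^2-\frac{1}{N_n(A)}\sum_{i:\mathbf{X}_i\in A}\big(Y_i-\bar Y_{A_L}\mathbf{1}\{X_{ji}<z\}-\bar Y_{A_R}\mathbf{1}\{X_{ji}\ge z\}\big)^2,$$ where sums run over points, $N_n(A)$ is the number of points in $A$, $\bar Y_A$ is the mean of the $Y_i$ of the points in $A$, and $X_{ji}$ is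 the $j$-th coordinate of $\mathbf{X}_i$. Replace $A$ by $A_L,A_R$. Cells without an admissible cut are left uncut. Stop when there are $t_n$ cells or no cell can be cut. (3) The tree estimate $m_n(\mathbf{x};\Theta,\mathcal{D}_n)$ is the mean of the $Y_i$ of the points in the final cell $A_n(\mathbf{x};\Theta)$ containing $\mathbf{x}$. The infinite forest estimate is $m_n(\mathbf{x})=m_n(\mathbf{x};\mathcal{D}_n)=\mathbb{E}_\Theta[m_n(\mathbf{x};\Theta,\mathcal{D}_n)]$, the expectation being over $\Theta$ only. Out-of-bag (OOB) prediction. For $n\ge2$ and $i\in\{1,\dots,n\}$ let $\mathcal{D}_n^{-(i)}=\mathcal{D}_n\setminus\{(\mathbf{X}_i,Y_i)\}$ (the sample with the $i$-th observation removed). The OOB prediction is the infinite forest built on these $n-1$ observations, evaluated at $\mathbf{X}_i$: $m_n^{OOB}(\mathbf{X}_i)=m_{n-1}(\mathbf{X}_i;\mathcal{D}_n^{-(i)})$, using the parameters $a_{n-1},t_{n-1}$. *)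

theory Defs
  imports "HOL-Probability.Probability"
begin

type_synonym 'p point = "(real^'p) \<times> real"

datatype resampling = With_Replacement | Without_Replacement

text \<open>
  A cell is stored by its lower and upper bounds.  Upper bounds are strict, because a cut sends
  the points on the cutting plane to the right; the initial cell gets the upper bound 2 so that
  the faces of the unit cube with a coordinate equal to 1 are not lost.
\<close>

type_synonym 'p cell = "(real^'p) \<times> (real^'p)"

definition cell_set :: "'p::finite cell \<Rightarrow> (real^'p) set" where
  "cell_set A = {x. \<forall>j. 0 \<le> x $ j \<and> x $ j \<le> 1 \<and> fst A $ j \<le> x $ j \<and> x $ j < snd A $ j}"

definition root_cell :: "'p::finite cell" where
  "root_cell = (\<chi> j. 0, \<chi> j. 2)"

definition left_part :: "(real^'p::finite) set \<Rightarrow> 'p \<Rightarrow> real \<Rightarrow> (real^'p) set" where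
  "left_part S j z = {x \<in> S. x $ j < z}"

definition right_part :: "(real^'p::finite) set \<Rightarrow> 'p \<Rightarrow> real \<Rightarrow> (real^'p) set" where
  "right_part S j z = {x \<in> S. x $ j \<ge> z}"

definition left_cell :: "'p::finite cell \<Rightarrow> 'p \<Rightarrow> real \<Rightarrow> 'p cell" where
  "left_cell A j z = (fst A, \<chi> k. if k = j then min z (snd A $ k) else snd A $ k)"

definition right_cell :: "'p::finite cell \<Rightarrow> 'p \<Rightarrow> real \<Rightarrow> 'p cell" where
  "right_cell A j z = (\<chi> k. if k = j then max z (fst A $ k) else fst A $ k, snd A)"

lemma cell_set_root: "cell_set root_cell = {x. \<forall>j. 0 \<le> x $ j \<and> x $ j \<le> 1}"
  unfolding cell_set_def root_cell_def by (force intro: le_less_trans[of _ 1 2])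

lemma cell_set_left: "cell_set (left_cell A j z) = left_part (cell_set A) j z"
proof (rule set_eqI)
  fix x
  have "(\<forall>k. x $ k < (if k = j then min z (snd A $ k) else snd A $ k)) \<longleftrightarrow>
      x $ j < z \<and> (\<forall>k. x $ k < snd A $ k)"
    by (auto split: if_splits)
  then show "x \<in> cell_set (left_cell A j z) \<longleftrightarrow> x \<in> left_part (cell_set A) j z"
    unfolding cell_set_def left_cell_def left_part_def all_conj_distrib by simp blast
qed

lemma cell_set_right: "cell_set (right_cell A j z) = right_part (cell_set A) j z"
proof (rule set_eqI)
  fix x
  have "(\<forall>k. (if k = j then max z (fst A $ k) else fst A $ k) \<le> x $ k) \<longleftrightarrow>
      z \<le> x $ j \<and> (\<forall>k. fst A $ k \<le> x $ k)"
    by (auto split: if_splits)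
  then show "x \<in> cell_set (right_cell A j z) \<longleftrightarrow> x \<in> right_part (cell_set A) j z"
    unfolding cell_set_def right_cell_def right_part_def all_conj_distrib by simp blast
qed

text \<open>
  Below, \<open>P 0, \<dots>, P (a - 1)\<close> are the points selected for a tree, so that a data point drawn
  several times is counted with multiplicity.
\<close>

definition points_in :: "nat \<Rightarrow> (nat \<Rightarrow> 'p::finite point) \<Rightarrow> (real^'p) set \<Rightarrow> nat set" where
  "points_in a P S = {k. k < a \<and> fst (P k) \<in> S}"

definition mean_in :: "nat \<Rightarrow> (nat \<Rightarrow> 'p::finite point) \<Rightarrow> (real^'p) set \<Rightarrow> real" where
  "mean_in a P S = (\<Sum>k\<in>points_in a P S. snd (P k)) / real (card (points_in a P S))"

definition variance_decrease ::
    "nat \<Rightarrow> (nat \<Rightarrow> 'p::finite point) \<Rightarrow> (real^'p) set \<Rightarrow> 'p \<Rightarrow> real \<Rightarrow> real" where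
  "variance_decrease a P S j z =
     1 / real (card (points_in a P S)) *
       (\<Sum>k\<in>points_in a P S. (snd (P k) - mean_in a P S)\<^sup>2)
   - 1 / real (card (points_in a P S)) *
       (\<Sum>k\<in>points_in a P S.
          (snd (P k) - mean_in a P (left_part S j z) * of_bool (fst (P k) $ j < z)
                     - mean_in a P (right_part S j z) * of_bool (fst (P k) $ j \<ge> z))\<^sup>2)"

definition admissible_cuts ::
    "nat \<Rightarrow> (nat \<Rightarrow> 'p::finite point) \<Rightarrow> 'p set \<Rightarrow> (real^'p) set \<Rightarrow> ('p \<times> real) set" where
  "admissible_cuts a P M S = {(j, z). j \<in> M \<and> 0 \<le> z \<and> z \<le> 1 \<and>
     points_in a P (left_part S j z) \<noteq> {} \<and> points_in a P (right_part S j z) \<noteq> {}}"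

definition optimal_cuts ::
    "nat \<Rightarrow> (nat \<Rightarrow> 'p::finite point) \<Rightarrow> 'p set \<Rightarrow> (real^'p) set \<Rightarrow> ('p \<times> real) set" where
  "optimal_cuts a P M S = {(j, z) \<in> admissible_cuts a P M S.
     \<forall>(j', z') \<in> admissible_cuts a P M S.
       variance_decrease a P S j' z' \<le> variance_decrease a P S j z}"

text \<open>
  The rule that selects one of the optimal cuts sees the selected points, the set of drawn
  directions and the cell.  Measurability refers to points indexed by \<open>{..<a}\<close>.
\<close>

type_synonym 'p cut_rule = "nat \<Rightarrow> 'p set \<Rightarrow> (nat \<Rightarrow> 'p point) \<Rightarrow> 'p cell \<Rightarrow> 'p \<times> real"

definition measurable_cut_rule :: "'p::finite cut_rule \<Rightarrow> bool" where
  "measurable_cut_rule rule \<longleftrightarrow>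
     (\<forall>a M P A. admissible_cuts a P M (cell_set A) \<noteq> {} \<longrightarrow>
        rule a M P A \<in> optimal_cuts a P M (cell_set A)) \<and>
     (\<forall>a M. (\<lambda>(P, A). rule a M P A)
        \<in> (Pi\<^sub>M {..<a} (\<lambda>_. borel) \<Otimes>\<^sub>M borel) \<rightarrow>\<^sub>M (count_space UNIV \<Otimes>\<^sub>M borel))"

text \<open>
  Cells that still have to be treated wait in a first-in first-out queue, which amounts to going
  through the levels of the tree one after the other, from left to right within a level; cells
  found to have no admissible cut are moved to the last argument.  Every treated cell consumes
  one set of directions.
\<close>

fun grow :: "'p::finite cut_rule \<Rightarrow> nat \<Rightarrow> nat \<Rightarrow> (nat \<Rightarrow> 'p point) \<Rightarrow> 'p set list \<Rightarrow>
    'p cell list \<Rightarrow> 'p cell list \<Rightarrow> 'p cell list" where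
  "grow rule t a P [] queue fin = queue @ fin"
| "grow rule t a P (M # Ms) [] fin = fin"
| "grow rule t a P (M # Ms) (A # queue) fin =
     (if t \<le> length (A # queue @ fin) then A # queue @ fin
      else if admissible_cuts a P M (cell_set A) = {} then grow rule t a P Ms queue (A # fin)
      else case rule a M P A of (j, z) \<Rightarrow>
        grow rule t a P Ms (queue @ [left_cell A j z, right_cell A j z]) fin)"

definition selections :: "resampling \<Rightarrow> nat \<Rightarrow> nat \<Rightarrow> (nat \<Rightarrow> nat) set" where
  "selections S n a = (case S of
      With_Replacement \<Rightarrow> {..<a} \<rightarrow>\<^sub>E {1..n}
    | Without_Replacement \<Rightarrow> {s \<in> {..<a} \<rightarrow>\<^sub>E {1..n}. inj_on s {..<a}})"

text \<open>
  The distribution of the auxiliary randomness: the uniform distribution on a finite product,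
  hence an independent uniform selection and independent uniform sets of directions.  A tree with
  at most \<open>a\<close> leaves has at most \<open>2 * a - 1\<close> nodes, so \<open>2 * a\<close> sets of directions always suffice;
  see \<open>grow_terminated\<close> below.
\<close>

definition theta_pmf ::
    "nat \<Rightarrow> resampling \<Rightarrow> nat \<Rightarrow> nat \<Rightarrow> ((nat \<Rightarrow> nat) \<times> 'p::finite set list) pmf" where
  "theta_pmf mtry S n a = pmf_of_set
     (selections S n a \<times> {Ms. length Ms = 2 * a \<and> (\<forall>M\<in>set Ms. card M = mtry)})"

definition tree_estimate :: "'p::finite cut_rule \<Rightarrow> nat \<Rightarrow> nat \<Rightarrow>
    (nat \<Rightarrow> nat) \<times> 'p set list \<Rightarrow> (nat \<Rightarrow> 'p point) \<Rightarrow> real^'p \<Rightarrow> real" where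
  "tree_estimate rule a t \<theta> D x =
     (let P = (\<lambda>k\<in>{..<a}. D (fst \<theta> k)) in
      case find (\<lambda>A. x \<in> cell_set A) (grow rule t a P (snd \<theta>) [root_cell] []) of
        Some A \<Rightarrow> mean_in a P (cell_set A)
      | None \<Rightarrow> 0)"

text \<open>The data set of size \<open>n\<close> consists of \<open>D 1, \<dots>, D n\<close>; other values of \<open>D\<close> are ignored.\<close>

definition forest_estimate :: "nat \<Rightarrow> resampling \<Rightarrow> 'p::finite cut_rule \<Rightarrow>
    (nat \<Rightarrow> nat) \<Rightarrow> (nat \<Rightarrow> nat) \<Rightarrow> nat \<Rightarrow> (nat \<Rightarrow> 'p point) \<Rightarrow> real^'p \<Rightarrow> real" where
  "forest_estimate mtry S rule a t n D x =
     measure_pmf.expectation (theta_pmf mtry S n (a n))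
       (\<lambda>\<theta>. tree_estimate rule (a n) (t n) \<theta> D x)"

text \<open>Index 0 is the generic pair \<open>(X, Y)\<close>; the observations have the indices \<open>1, 2, \<dots>\<close>.\<close>

definition sample ::
    "(nat \<Rightarrow> 'w \<Rightarrow> real^'p::finite) \<Rightarrow> (nat \<Rightarrow> 'w \<Rightarrow> real) \<Rightarrow> 'w \<Rightarrow> nat \<Rightarrow> 'p point" where
  "sample X Y \<omega> i = (X i \<omega>, Y i \<omega>)"

definition leave_out :: "nat \<Rightarrow> (nat \<Rightarrow> 'b) \<Rightarrow> nat \<Rightarrow> 'b" where
  "leave_out i D k = (if k < i then D k else D (Suc k))"

definition oob_prediction :: "nat \<Rightarrow> resampling \<Rightarrow> 'p::finite cut_rule \<Rightarrow>
    (nat \<Rightarrow> nat) \<Rightarrow> (nat \<Rightarrow> nat) \<Rightarrow> nat \<Rightarrow> (nat \<Rightarrow> 'p point) \<Rightarrow> nat \<Rightarrow> real" where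
  "oob_prediction mtry S rule a t n D i =
     forest_estimate mtry S rule a t (n - 1) (leave_out i D) (fst (D i))"

definition oob_residual :: "nat \<Rightarrow> resampling \<Rightarrow> 'p::finite cut_rule \<Rightarrow>
    (nat \<Rightarrow> nat) \<Rightarrow> (nat \<Rightarrow> nat) \<Rightarrow> nat \<Rightarrow> (nat \<Rightarrow> 'p point) \<Rightarrow> nat \<Rightarrow> real" where
  "oob_residual mtry S rule a t n D i = snd (D i) - oob_prediction mtry S rule a t n D i"

definition sigma2_RF :: "nat \<Rightarrow> resampling \<Rightarrow> 'p::finite cut_rule \<Rightarrow>
    (nat \<Rightarrow> nat) \<Rightarrow> (nat \<Rightarrow> nat) \<Rightarrow> nat \<Rightarrow> (nat \<Rightarrow> 'p point) \<Rightarrow> real" where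
  "sigma2_RF mtry S rule a t n D =
     (let e = oob_residual mtry S rule a t n D;
          e_mean = (\<Sum>i=1..n. e i) / real n
      in (\<Sum>i=1..n. (e i - e_mean)\<^sup>2) / real n)"

text \<open>The library's \<open>indep_var\<close> requires both random variables to have the same type.\<close>

definition indep_random_variables ::
    "'w measure \<Rightarrow> 'b measure \<Rightarrow> ('w \<Rightarrow> 'b) \<Rightarrow> 'c measure \<Rightarrow> ('w \<Rightarrow> 'c) \<Rightarrow> bool" where
  "indep_random_variables M N1 U N2 V \<longleftrightarrow> U \<in> M \<rightarrow>\<^sub>M N1 \<and> V \<in> M \<rightarrow>\<^sub>M N2 \<and>
     prob_space.indep_set M {U -` A \<inter> space M | A. A \<in> sets N1}
                            {V -` B \<inter> space M | B. B \<in> sets N2}"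

lemma grow_append:
  assumes "measurable_cut_rule rule"
  shows "(\<Sum>A\<leftarrow>queue. 2 * max 1 (card (points_in a P (cell_set A))) - 1) \<le> length Ms \<Longrightarrow>
    grow rule t a P (Ms @ Ms') queue fin = grow rule t a P Ms queue fin"
proof (induction Ms arbitrary: queue fin)
  case Nil
  then have "queue = []"
    by (cases queue) auto
  then show ?case
    by (cases Ms') auto
next
  case (Cons M Ms)
  show ?case
  proof (cases queue)
    case Nil
    then show ?thesis by simp
  next
    case q: (Cons A As)
    show ?thesis
    proof (cases "admissible_cuts a P M (cell_set A) = {}")
      case True
      have "(\<Sum>A\<leftarrow>As. 2 * max 1 (card (points_in a P (cell_set A))) - 1) \<le> length Ms"
        using Cons.prems q by simp
      then show ?thesis
        using Cons.IH True q by simp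
    next
      case False
      obtain j z where c: "rule a M P A = (j, z)"
        by fastforce
      let ?N = "\<lambda>A. points_in a P (cell_set A)"
      have "(j, z) \<in> admissible_cuts a P M (cell_set A)"
        using assms False c
        unfolding measurable_cut_rule_def optimal_cuts_def by fastforce
      then have ne: "?N (left_cell A j z) \<noteq> {}" "?N (right_cell A j z) \<noteq> {}"
        by (auto simp: admissible_cuts_def cell_set_left cell_set_right)
      have fin: "finite (?N B)" for B
        by (auto simp: points_in_def)
      have un: "?N A = ?N (left_cell A j z) \<union> ?N (right_cell A j z)"
        "?N (left_cell A j z) \<inter> ?N (right_cell A j z) = {}"
        by (auto simp: points_in_def cell_set_left cell_set_right left_part_def right_part_def)
      have "card (?N A) = card (?N (left_cell A j z)) + card (?N (right_cell A j z))"
        using un fin by (metis card_Un_disjoint)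
      moreover have "card (?N (left_cell A j z)) > 0" "card (?N (right_cell A j z)) > 0"
        using ne fin by (auto simp: card_gt_0_iff)
      ultimately have "(\<Sum>A\<leftarrow>As @ [left_cell A j z, right_cell A j z].
          2 * max 1 (card (?N A)) - 1) \<le> length Ms"
        using Cons.prems q by (simp add: max_def split: if_splits)
      then show ?thesis
        using Cons.IH False q c by simp
    qed
  qed
qed

lemma grow_terminated:
  assumes "measurable_cut_rule rule" "1 \<le> a" "2 * a \<le> length Ms"
  shows "grow rule t a P (Ms @ Ms') [root_cell] fin = grow rule t a P Ms [root_cell] fin"
proof (rule grow_append[OF assms(1)])
  have "card (points_in a P (cell_set root_cell)) \<le> card {..<a}"
    by (rule card_mono) (auto simp: points_in_def)
  then show "(\<Sum>A\<leftarrow>[root_cell]. 2 * max 1 (card (points_in a P (cell_set A))) - 1) \<le> length Ms"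
    using assms(2,3) by auto
qed

lemma grow_partition:
  "length (filter (\<lambda>A. x \<in> cell_set A) (grow rule t a P Ms queue fin)) =
   length (filter (\<lambda>A. x \<in> cell_set A) (queue @ fin))"
proof (induction rule t a P Ms queue fin rule: grow.induct)
  case (3 rule t a P M Ms A queue fin)
  then show ?case
    by (cases "rule a M P A")
       (auto simp: cell_set_left cell_set_right left_part_def right_part_def)
qed auto

end

theory Submission
  imports Defs
begin

text \<open>
  Write the residuals as \<open>e\<^sub>i - r\<^sub>i\<close> with \<open>e\<^sub>i = Y\<^sub>i - m X\<^sub>i\<close> and \<open>r\<^sub>i\<close> the error of the out-of-bag
  prediction.  Moving the \<open>i\<close>-th observation to index 0 and closing the gap is an injective
  reindexing of an i.i.d. sequence, so \<open>r\<^sub>i\<close> is distributed like the error at \<open>X\<^sub>0\<close> of the forest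
  built from \<open>n - 1\<close> observations, and \<open>E r\<^sub>i\<^sup>2\<close> is the quantity that vanishes by assumption.
  Young's inequality bounds the effect of the \<open>r\<^sub>i\<close> on the empirical variance, and for the i.i.d.
  errors \<open>e\<^sub>i\<close> the claim is the \<open>L\<^sub>1\<close> law of large numbers for \<open>e\<^sub>i\<^sup>2\<close>.
\<close>

subsection \<open>Measurability and boundedness of the forest estimate\<close>

lemma measurable_fst_borel:
  fixes f :: "'a \<Rightarrow> 'b::second_countable_topology \<times> 'c::second_countable_topology"
  assumes "f \<in> borel_measurable N"
  shows "(\<lambda>w. fst (f w)) \<in> borel_measurable N"
  by (rule measurable_compose[OF assms])
    (intro borel_measurable_continuous_onI continuous_intros)

lemma measurable_snd_borel:
  fixes f :: "'a \<Rightarrow> 'b::second_countable_topology \<times> 'c::second_countable_topology"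
  assumes "f \<in> borel_measurable N"
  shows "(\<lambda>w. snd (f w)) \<in> borel_measurable N"
  by (rule measurable_compose[OF assms])
    (intro borel_measurable_continuous_onI continuous_intros)

lemma measurable_nth_borel:
  fixes f :: "'a \<Rightarrow> real^'p"
  assumes "f \<in> borel_measurable N"
  shows "(\<lambda>w. f w $ j) \<in> borel_measurable N"
  by (rule measurable_compose[OF assms borel_measurable_nth])

lemma measurable_vec_lambda_borel:
  fixes f :: "'p::finite \<Rightarrow> 'a \<Rightarrow> real"
  assumes "\<And>k. f k \<in> borel_measurable N"
  shows "(\<lambda>w. \<chi> k. f k w) \<in> borel_measurable N"
  using assms
  by (subst borel_measurable_euclidean_space) (auto simp: Basis_vec_def inner_axis)

lemma measurable_in_cell_set:
  assumes "x \<in> borel_measurable N" "A \<in> borel_measurable N"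
  shows "Measurable.pred N (\<lambda>w. x w \<in> cell_set (A w))"
proof -
  note [measurable] = assms
    measurable_nth_borel[OF assms(1)]
    measurable_nth_borel[OF measurable_fst_borel[OF assms(2)]]
    measurable_nth_borel[OF measurable_snd_borel[OF assms(2)]]
  show ?thesis
    unfolding cell_set_def mem_Collect_eq by measurable
qed

text \<open>Admissibility quantifies over a continuum of positions, which does not show its
  measurability. Comparing finitely many pairs of points suffices: any cut with points on both sides
  provides a pair with different coordinates, and any such pair can be separated.\<close>

lemma admissible_cuts_eq_empty_iff:
  "admissible_cuts a P M (cell_set A) = {} \<longleftrightarrow>
    \<not> (\<exists>j\<in>M. \<exists>k<a. \<exists>l<a. fst (P k) \<in> cell_set A \<and> fst (P l) \<in> cell_set A \<and>
        fst (P k) $ j < fst (P l) $ j)"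
proof -
  \<comment> \<open>The larger coordinate serves as the position: the point \<open>P l\<close> on
    the cutting plane goes right, and the position lies between 0 and 1 because cells lie in the
    unit cube.\<close>
  have "(j, fst (P l) $ j) \<in> admissible_cuts a P M (cell_set A)"
    if "j \<in> M" "k < a" "l < a" "fst (P k) \<in> cell_set A" "fst (P l) \<in> cell_set A"
      "fst (P k) $ j < fst (P l) $ j" for j k l
    using that
    by (auto simp: admissible_cuts_def points_in_def left_part_def right_part_def cell_set_def)
  moreover have "\<exists>k<a. \<exists>l<a. fst (P k) \<in> cell_set A \<and> fst (P l) \<in> cell_set A \<and>
      fst (P k) $ j < fst (P l) $ j"
    if "(j, z) \<in> admissible_cuts a P M (cell_set A)" for j z
    using that
    by (auto simp: admissible_cuts_def points_in_def left_part_def right_part_def)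
      (meson less_le_trans)
  moreover have "j \<in> M" if "(j, z) \<in> admissible_cuts a P M (cell_set A)" for j z
    using that by (auto simp: admissible_cuts_def)
  ultimately show ?thesis
    by (metis all_not_in_conv surj_pair)
qed

lemma measurable_admissible_cuts_empty:
  fixes P :: "'a \<Rightarrow> nat \<Rightarrow> 'p::finite point"
  assumes P: "\<And>k. k < a \<Longrightarrow> (\<lambda>w. P w k) \<in> borel_measurable N"
    and A: "A \<in> borel_measurable N"
  shows "Measurable.pred N (\<lambda>w. admissible_cuts a (P w) M (cell_set (A w)) = {})"
proof -
  have 1: "Measurable.pred N (\<lambda>w. fst (P w k) \<in> cell_set (A w) \<and> fst (P w l) \<in> cell_set (A w) \<and>
        fst (P w k) $ j < fst (P w l) $ j)" if "k < a" "l < a" for j k l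
  proof -
    note [measurable] = measurable_in_cell_set[OF measurable_fst_borel[OF P] A]
      measurable_nth_borel[OF measurable_fst_borel[OF P]]
    show ?thesis using that by measurable
  qed
  have "Measurable.pred N (\<lambda>w. \<exists>j\<in>M. \<exists>k\<in>{..<a}. \<exists>l\<in>{..<a}.
      fst (P w k) \<in> cell_set (A w) \<and> fst (P w l) \<in> cell_set (A w) \<and>
        fst (P w k) $ j < fst (P w l) $ j)"
    by (intro pred_intros_finite finite_lessThan finite 1) auto
  then show ?thesis
    unfolding admissible_cuts_eq_empty_iff Bex_def lessThan_iff by measurable
qed

lemma measurable_left_cell:
  assumes A: "A \<in> borel_measurable N" and [measurable]: "j \<in> N \<rightarrow>\<^sub>M count_space UNIV"
    and [measurable]: "z \<in> borel_measurable N"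
  shows "(\<lambda>w. left_cell (A w) (j w) (z w)) \<in> borel_measurable N"
proof -
  note [measurable] = measurable_fst_borel[OF A] measurable_snd_borel[OF A]
    measurable_nth_borel[OF measurable_snd_borel[OF A]]
  have "(\<lambda>w. \<chi> k. if k = j w then min (z w) (snd (A w) $ k) else snd (A w) $ k)
      \<in> borel_measurable N"
    by (rule measurable_vec_lambda_borel) measurable
  then show ?thesis
    unfolding left_cell_def by measurable
qed

lemma measurable_right_cell:
  assumes A: "A \<in> borel_measurable N" and [measurable]: "j \<in> N \<rightarrow>\<^sub>M count_space UNIV"
    and [measurable]: "z \<in> borel_measurable N"
  shows "(\<lambda>w. right_cell (A w) (j w) (z w)) \<in> borel_measurable N"
proof -
  note [measurable] = measurable_fst_borel[OF A] measurable_snd_borel[OF A]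
    measurable_nth_borel[OF measurable_fst_borel[OF A]]
  have "(\<lambda>w. \<chi> k. if k = j w then max (z w) (fst (A w) $ k) else fst (A w) $ k)
      \<in> borel_measurable N"
    by (rule measurable_vec_lambda_borel) measurable
  then show ?thesis
    unfolding right_cell_def by measurable
qed

section \<open>Measurability of leaf means and of a single tree\<close>

lemma measurable_mean_in:
  fixes P :: "'a \<Rightarrow> nat \<Rightarrow> 'p::finite point"
  assumes P: "\<And>k. k < a \<Longrightarrow> (\<lambda>w. P w k) \<in> borel_measurable N"
    and A: "A \<in> borel_measurable N"
  shows "(\<lambda>w. mean_in a (P w) (cell_set (A w))) \<in> borel_measurable N"
proof -
  \<comment> \<open>The index set of the mean varies with the outcome, so numerator and denominator
    become sums over the fixed set \<open>{..<a}\<close>, with membership in \<open>S\<close> tested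
    inside the summands.\<close>
  have eq: "mean_in a P' S = (\<Sum>k<a. if fst (P' k) \<in> S then snd (P' k) else 0) /
      (\<Sum>k<a. if fst (P' k) \<in> S then 1 else 0)" for P' :: "nat \<Rightarrow> 'p point" and S
  proof -
    have "points_in a P' S = {..<a} \<inter> {k. fst (P' k) \<in> S}"
      by (auto simp: points_in_def)
    then show ?thesis
      by (simp add: mean_in_def sum.If_cases)
  qed
  note [measurable (raw)] = measurable_in_cell_set[OF measurable_fst_borel[OF P] A]
    measurable_snd_borel[OF P]
  show ?thesis
    unfolding eq
    by (intro borel_measurable_divide borel_measurable_sum measurable_If) auto
qed

text \<open>The number of final cells is random. Instead of a sigma-algebra on lists of cells, the
  induction over \<open>Ms\<close> carries lists of measurable cell-valued maps, whose lengths are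
  deterministic. Each random decision becomes a case distinction on a measurable event, with both
  continuations covered by the induction hypothesis.\<close>

lemma measurable_grow_mean:
  fixes P :: "'a \<Rightarrow> nat \<Rightarrow> 'p::finite point" and queue fin :: "('a \<Rightarrow> 'p cell) list"
  assumes rule: "measurable_cut_rule rule"
    and P: "P \<in> N \<rightarrow>\<^sub>M Pi\<^sub>M {..<a} (\<lambda>_. borel)" and x: "x \<in> borel_measurable N"
  shows "set queue \<union> set fin \<subseteq> borel_measurable N \<Longrightarrow>
    (\<lambda>w. case find (\<lambda>A. x w \<in> cell_set A)
        (grow rule t a (P w) Ms (map (\<lambda>f. f w) queue) (map (\<lambda>f. f w) fin)) of
        Some A \<Rightarrow> mean_in a (P w) (cell_set A) | None \<Rightarrow> 0) \<in> borel_measurable N"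
proof -
  define G :: "'a \<Rightarrow> 'p cell list \<Rightarrow> real" where
    "G w L = (case find (\<lambda>A. x w \<in> cell_set A) L of
        Some A \<Rightarrow> mean_in a (P w) (cell_set A) | None \<Rightarrow> 0)" for w L
  have Pk: "(\<lambda>w. P w k) \<in> borel_measurable N" if "k < a" for k
    using measurable_compose[OF P measurable_component_singleton[of k]] that by simp
  \<comment> \<open>For a fixed list of measurable cells, \<open>find\<close> unfolds into nested
    case distinctions on the events that \<open>x w\<close> lies in the successive cells.\<close>
  have G: "(\<lambda>w. G w (map (\<lambda>f. f w) L)) \<in> borel_measurable N"
    if "set L \<subseteq> borel_measurable N" for L
    using that
  proof (induction L)
    case Nil
    then show ?case by (simp add: G_def)
  next
    case (Cons f L)
    have "G w (map (\<lambda>f. f w) (f # L)) = (if x w \<in> cell_set (f w)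
        then mean_in a (P w) (cell_set (f w)) else G w (map (\<lambda>f. f w) L))" for w
      by (simp add: G_def)
    moreover have "(\<lambda>w. if x w \<in> cell_set (f w)
        then mean_in a (P w) (cell_set (f w)) else G w (map (\<lambda>f. f w) L)) \<in> borel_measurable N"
      using Cons by (intro measurable_If measurable_mean_in Pk measurable_in_cell_set x
          predE) auto
    ultimately show ?case by simp
  qed
  have "(\<lambda>w. G w (grow rule t a (P w) Ms (map (\<lambda>f. f w) queue) (map (\<lambda>f. f w) fin)))
      \<in> borel_measurable N"
    if "set queue \<union> set fin \<subseteq> borel_measurable N"
    using that
  proof (induction Ms arbitrary: queue fin)
    case Nil
    then show ?case
      using G[of "queue @ fin"] by simp
  next
    case (Cons M Ms)
    show ?case
    proof (cases queue)
      case Nil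
      then show ?thesis using G[of fin] Cons.prems by simp
    next
      case q: (Cons A As)
      have A: "A \<in> borel_measurable N" and As: "set As \<subseteq> borel_measurable N"
        and fin: "set fin \<subseteq> borel_measurable N"
        using Cons.prems q by auto
      define c where "c w = rule a M (P w) (A w)" for w
      have c: "c \<in> N \<rightarrow>\<^sub>M count_space UNIV \<Otimes>\<^sub>M borel"
      proof -
        \<comment> \<open>Here the cell depends on the outcome as well as the points, so the rule
          has to be measurable jointly in both.\<close>
        have "(\<lambda>w. (P w, A w)) \<in> N \<rightarrow>\<^sub>M (Pi\<^sub>M {..<a} (\<lambda>_. borel) \<Otimes>\<^sub>M borel)"
          using P A by (rule measurable_Pair)
        moreover have "(\<lambda>(P, A). rule a M P A)
            \<in> (Pi\<^sub>M {..<a} (\<lambda>_. borel) \<Otimes>\<^sub>M borel) \<rightarrow>\<^sub>M (count_space UNIV \<Otimes>\<^sub>M borel)"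
          using rule by (simp add: measurable_cut_rule_def)
        ultimately have "(\<lambda>w. case (P w, A w) of (P, A) \<Rightarrow> rule a M P A)
            \<in> N \<rightarrow>\<^sub>M (count_space UNIV \<Otimes>\<^sub>M borel)"
          by (rule measurable_compose)
        then show ?thesis
          by (simp add: c_def[abs_def])
      qed
      define l where "l w = left_cell (A w) (fst (c w)) (snd (c w))" for w
      define r where "r w = right_cell (A w) (fst (c w)) (snd (c w))" for w
      have l: "l \<in> borel_measurable N" and r: "r \<in> borel_measurable N"
        unfolding l_def r_def
        by (intro measurable_left_cell measurable_right_cell A
            measurable_compose[OF c] measurable_fst measurable_snd)+
      \<comment> \<open>The stopping test only counts cells, hence does not depend on
        \<open>w\<close> and is decided first; only the existence of an admissible cut remains a
        random event.\<close>
      show ?thesis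
      proof (cases "t \<le> length (A # As @ fin)")
        case True
        then show ?thesis
          using G[of "A # As @ fin"] Cons.prems q by simp
      next
        case False
        have "(\<lambda>w. if admissible_cuts a (P w) M (cell_set (A w)) = {}
            then G w (grow rule t a (P w) Ms (map (\<lambda>f. f w) As) (map (\<lambda>f. f w) (A # fin)))
            else G w (grow rule t a (P w) Ms (map (\<lambda>f. f w) (As @ [l, r]))
              (map (\<lambda>f. f w) fin))) \<in> borel_measurable N"
          using A As fin l r
          by (intro measurable_If Cons.IH predE measurable_admissible_cuts_empty Pk) auto
        moreover have "G w (grow rule t a (P w) (M # Ms) (map (\<lambda>f. f w) queue)
              (map (\<lambda>f. f w) fin)) =
            (if admissible_cuts a (P w) M (cell_set (A w)) = {}
            then G w (grow rule t a (P w) Ms (map (\<lambda>f. f w) As) (map (\<lambda>f. f w) (A # fin)))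
            else G w (grow rule t a (P w) Ms (map (\<lambda>f. f w) (As @ [l, r]))
              (map (\<lambda>f. f w) fin)))" for w
          using False by (simp add: q l_def r_def c_def split: prod.split)
        ultimately show ?thesis by simp
      qed
    qed
  qed
  then show "set queue \<union> set fin \<subseteq> borel_measurable N \<Longrightarrow> ?thesis"
    unfolding G_def .
qed

lemma measurable_tree_estimate:
  fixes D :: "'a \<Rightarrow> nat \<Rightarrow> 'p::finite point"
  assumes rule: "measurable_cut_rule rule"
    and D: "\<And>k. (\<lambda>w. D w k) \<in> borel_measurable N" and x: "x \<in> borel_measurable N"
  shows "(\<lambda>w. tree_estimate rule a t \<theta> (D w) (x w)) \<in> borel_measurable N"
proof -
  have "(\<lambda>w. \<lambda>k\<in>{..<a}. D w (fst \<theta> k)) \<in> N \<rightarrow>\<^sub>M Pi\<^sub>M {..<a} (\<lambda>_. borel)"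
    by (intro measurable_restrict D)
  from measurable_grow_mean[OF rule this x, of "[\<lambda>_. root_cell]" "[]" t "snd \<theta>"]
  show ?thesis
    by (simp add: tree_estimate_def Let_def)
qed

section \<open>Dependence of a tree on the data and bounds by the responses\<close>

lemma tree_estimate_cong:
  assumes "\<And>k. k < a \<Longrightarrow> D (fst \<theta> k) = D' (fst \<theta> k)"
  shows "tree_estimate rule a t \<theta> D x = tree_estimate rule a t \<theta> D' x"
proof -
  have "(\<lambda>k\<in>{..<a}. D (fst \<theta> k)) = (\<lambda>k\<in>{..<a}. D' (fst \<theta> k))"
    using assms by auto
  then show ?thesis
    by (simp add: tree_estimate_def)
qed

lemma abs_mean_in_le:
  assumes "\<And>k. k < a \<Longrightarrow> \<bar>snd (P k)\<bar> \<le> B" "0 \<le> B"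
  shows "\<bar>mean_in a P S\<bar> \<le> B"
proof -
  have "\<bar>\<Sum>k\<in>points_in a P S. snd (P k)\<bar> \<le> (\<Sum>k\<in>points_in a P S. B)"
    using assms by (intro order.trans[OF sum_abs] sum_mono) (auto simp: points_in_def)
  \<comment> \<open>Without points in \<open>S\<close> the mean is 0 by the convention for division
    by zero; this case uses that \<open>B\<close> is nonnegative.\<close>
  then show ?thesis
    using assms(2)
    by (cases "card (points_in a P S) = 0")
      (auto simp: mean_in_def abs_divide divide_le_eq mult.commute)
qed

lemma abs_tree_estimate_le:
  assumes "\<And>k. k < a \<Longrightarrow> \<bar>snd (D (fst \<theta> k))\<bar> \<le> B" "0 \<le> B"
  shows "\<bar>tree_estimate rule a t \<theta> D x\<bar> \<le> B"
  using assms
  by (auto simp: tree_estimate_def Let_def intro!: abs_mean_in_le split: option.split)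

section \<open>The forest as a finite average over the auxiliary randomness\<close>

definition thetas :: "nat \<Rightarrow> resampling \<Rightarrow> nat \<Rightarrow> nat \<Rightarrow> ((nat \<Rightarrow> nat) \<times> 'p::finite set list) set" where
  "thetas mtry S n a =
     selections S n a \<times> {Ms. length Ms = 2 * a \<and> (\<forall>M\<in>set Ms. card M = mtry)}"

lemma finite_thetas: "finite (thetas mtry S n a :: ((nat \<Rightarrow> nat) \<times> 'p::finite set list) set)"
proof -
  have "finite (selections S n a)"
    by (rule finite_subset[of _ "{..<a} \<rightarrow>\<^sub>E {1..n}"])
      (auto simp: selections_def intro!: finite_PiE split: resampling.splits)
  moreover have "finite {Ms :: 'p set list. length Ms = 2 * a \<and> (\<forall>M\<in>set Ms. card M = mtry)}"
    by (rule finite_subset[OF _ finite_lists_length_eq[of UNIV "2 * a"]]) auto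
  ultimately show ?thesis
    by (simp add: thetas_def)
qed

text \<open>Needed because \<open>pmf_of_set\<close> is uniform only on a nonempty finite set. The
  witness selects the first \<open>a\<close> observations; being injective, it is allowed under both
  resampling strategies.\<close>

lemma thetas_nonempty:
  assumes "1 \<le> n" "a \<le> n" "mtry \<le> CARD('p)"
  shows "(thetas mtry S n a :: ((nat \<Rightarrow> nat) \<times> 'p::finite set list) set) \<noteq> {}"
proof -
  have "(\<lambda>k\<in>{..<a}. Suc k) \<in> selections S n a"
    using assms by (auto simp: selections_def inj_on_def split: resampling.split)
  moreover obtain M :: "'p set" where "card M = mtry"
    using obtain_subset_with_card_n[OF assms(3)] by metis
  then have "replicate (2 * a) M \<in> {Ms. length Ms = 2 * a \<and> (\<forall>M\<in>set Ms. card M = mtry)}"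
    by auto
  ultimately show ?thesis
    unfolding thetas_def by blast
qed

lemma fst_thetas_mem: "\<theta> \<in> thetas mtry S n a \<Longrightarrow> k < a \<Longrightarrow> fst \<theta> k \<in> {1..n}"
  by (auto simp: thetas_def selections_def PiE_iff split: resampling.splits)

text \<open>With the expectation over the auxiliary randomness reduced to a finite sum,
  measurability, bounds and congruence pass directly from trees to the forest.\<close>

lemma forest_estimate_eq_average:
  fixes rule :: "'p::finite cut_rule"
  assumes "1 \<le> n" "a n \<le> n" "mtry \<le> CARD('p)"
  shows "forest_estimate mtry S rule a t n D x =
    (\<Sum>\<theta>\<in>thetas mtry S n (a n). tree_estimate rule (a n) (t n) \<theta> D x) /
      real (card (thetas mtry S n (a n) :: ((nat \<Rightarrow> nat) \<times> 'p set list) set))"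
  unfolding forest_estimate_def theta_pmf_def thetas_def[symmetric]
  by (rule integral_pmf_of_set) (use assms thetas_nonempty finite_thetas in auto)

lemma measurable_forest_estimate:
  fixes D :: "'a \<Rightarrow> nat \<Rightarrow> 'p::finite point"
  assumes "1 \<le> n" "a n \<le> n" "mtry \<le> CARD('p)" "measurable_cut_rule rule"
    and "\<And>k. (\<lambda>w. D w k) \<in> borel_measurable N" and "x \<in> borel_measurable N"
  shows "(\<lambda>w. forest_estimate mtry S rule a t n (D w) (x w)) \<in> borel_measurable N"
  unfolding forest_estimate_eq_average[of n a mtry, OF assms(1-3)]
  by (intro borel_measurable_divide borel_measurable_sum measurable_tree_estimate assms
      borel_measurable_const)

text \<open>Selections take values in \<open>{1..n}\<close>, so index 0 and indices beyond
  \<open>n\<close> never enter. Thus index 0 of the same sequence can hold the point of prediction,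
  and a shifted sequence can stand for a sample with one observation removed.\<close>

lemma forest_estimate_cong:
  fixes rule :: "'p::finite cut_rule"
  assumes "1 \<le> n" "a n \<le> n" "mtry \<le> CARD('p)"
    and "\<And>k. 1 \<le> k \<Longrightarrow> k \<le> n \<Longrightarrow> D k = D' k"
  shows "forest_estimate mtry S rule a t n D x = forest_estimate mtry S rule a t n D' x"
proof -
  have "tree_estimate rule (a n) (t n) \<theta> D x = tree_estimate rule (a n) (t n) \<theta> D' x"
    if "\<theta> \<in> thetas mtry S n (a n)" for \<theta>
    using fst_thetas_mem[OF that] by (intro tree_estimate_cong assms(4)) auto
  then show ?thesis
    unfolding forest_estimate_eq_average[of n a mtry, OF assms(1-3)] by simp
qed

text \<open>Every leaf mean is at most the largest absolute response. The cruder sum is chosen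
  because it is square integrable once the responses are, which yields square integrability of the
  forest estimate.\<close>

lemma abs_forest_estimate_le:
  fixes rule :: "'p::finite cut_rule"
  assumes "1 \<le> n" "a n \<le> n" "mtry \<le> CARD('p)"
  shows "\<bar>forest_estimate mtry S rule a t n D x\<bar> \<le> (\<Sum>i=1..n. \<bar>snd (D i)\<bar>)"
proof -
  let ?T = "thetas mtry S n (a n) :: ((nat \<Rightarrow> nat) \<times> 'p set list) set"
  let ?B = "\<Sum>i=1..n. \<bar>snd (D i)\<bar>"
  have "\<bar>tree_estimate rule (a n) (t n) \<theta> D x\<bar> \<le> ?B" if "\<theta> \<in> ?T" for \<theta>
    using fst_thetas_mem[OF that]
    by (intro abs_tree_estimate_le sum_nonneg member_le_sum[of _ _ "\<lambda>i. \<bar>snd (D i)\<bar>"]) auto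
  then have "\<bar>\<Sum>\<theta>\<in>?T. tree_estimate rule (a n) (t n) \<theta> D x\<bar> \<le> real (card ?T) * ?B"
    by (intro order.trans[OF sum_abs] sum_bounded_above) auto
  moreover have "0 < card ?T"
    using thetas_nonempty[OF assms] finite_thetas by (simp add: card_gt_0_iff)
  ultimately show ?thesis
    unfolding forest_estimate_eq_average[of n a mtry, OF assms]
    by (simp add: abs_divide divide_le_eq mult.commute)
qed

subsection \<open>I.i.d. sequences\<close>

lemma expectation_cong_distr:
  fixes g :: "'b \<Rightarrow> real"
  assumes d: "distr M N U = distr M N V" and U: "U \<in> M \<rightarrow>\<^sub>M N" and V: "V \<in> M \<rightarrow>\<^sub>M N"
    and g: "g \<in> borel_measurable N"
  shows "(\<integral>\<omega>. g (U \<omega>) \<partial>M) = (\<integral>\<omega>. g (V \<omega>) \<partial>M)"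
    and "integrable M (\<lambda>\<omega>. g (U \<omega>)) \<longleftrightarrow> integrable M (\<lambda>\<omega>. g (V \<omega>))"
  using integral_distr[OF U g] integral_distr[OF V g] integrable_distr_eq[OF U g]
    integrable_distr_eq[OF V g] d by simp_all

lemma integrable_mult_of_squares:
  fixes f g :: "'a \<Rightarrow> real"
  assumes [measurable]: "f \<in> borel_measurable M" "g \<in> borel_measurable M"
    and "integrable M (\<lambda>x. (f x)\<^sup>2)" "integrable M (\<lambda>x. (g x)\<^sup>2)"
  shows "integrable M (\<lambda>x. f x * g x)"
proof (rule Bochner_Integration.integrable_bound)
  show "integrable M (\<lambda>x. (f x)\<^sup>2 + (g x)\<^sup>2)"
    using assms by simp
  have "\<bar>u * v\<bar> \<le> u\<^sup>2 + v\<^sup>2" for u v :: real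
  proof -
    have "0 \<le> (\<bar>u\<bar> - \<bar>v\<bar>)\<^sup>2" "0 \<le> \<bar>u * v\<bar>" by simp_all
    then show ?thesis unfolding power2_diff power2_abs abs_mult by linarith
  qed
  then show "AE x in M. norm (f x * g x) \<le> norm ((f x)\<^sup>2 + (g x)\<^sup>2)"
    by simp
qed simp

lemma integrable_square_add:
  fixes f g :: "'a \<Rightarrow> real"
  assumes "f \<in> borel_measurable M" "g \<in> borel_measurable M"
    and "integrable M (\<lambda>x. (f x)\<^sup>2)" "integrable M (\<lambda>x. (g x)\<^sup>2)"
  shows "integrable M (\<lambda>x. (f x + g x)\<^sup>2)"
  unfolding power2_sum using integrable_mult_of_squares[OF assms] assms
  by (simp add: mult.assoc)

lemma integrable_square_sum:
  fixes f :: "'i \<Rightarrow> 'a \<Rightarrow> real"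
  assumes "finite I" "\<And>i. i \<in> I \<Longrightarrow> f i \<in> borel_measurable M"
    and "\<And>i. i \<in> I \<Longrightarrow> integrable M (\<lambda>x. (f i x)\<^sup>2)"
  shows "integrable M (\<lambda>x. (\<Sum>i\<in>I. f i x)\<^sup>2)"
  using assms
proof (induction I rule: finite_induct)
  case (insert i I)
  then show ?case
    by (simp add: integrable_square_add)
qed simp

section \<open>Reindexing, second moments and a law of large numbers\<close>

context prob_space
begin

text \<open>By independence the joint law is the infinite power of the common law
  \<open>?\<nu>\<close>. Pulling back along an injective index map repeats no factor and therefore
  gives the same power.\<close>

lemma distr_iid_reindex:
  assumes ind: "indep_vars (\<lambda>_. N) Z UNIV"
    and same: "\<And>i. distr M N (Z i) = distr M N (Z 0)" and "inj \<tau>"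
  shows "distr M (Pi\<^sub>M UNIV (\<lambda>_. N)) (\<lambda>\<omega> i. Z (\<tau> i) \<omega>) =
    distr M (Pi\<^sub>M (UNIV :: nat set) (\<lambda>_. N)) (\<lambda>\<omega> i. Z i \<omega>)"
proof -
  have rv: "random_variable N (Z i)" for i
    using ind by (simp add: indep_vars_def2)
  let ?\<nu> = "distr M N (Z 0)"
  let ?Q = "Pi\<^sub>M UNIV (\<lambda>_::nat. N)"
  have "(\<lambda>i. distr M N (Z i)) = (\<lambda>_. ?\<nu>)"
    using same by (rule ext)
  then have Z: "distr M ?Q (\<lambda>\<omega> i. Z i \<omega>) = Pi\<^sub>M UNIV (\<lambda>_. ?\<nu>)"
    using indep_vars_iff_distr_eq_PiM[where I = UNIV and M' = "\<lambda>_. N" and X = Z] ind rv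
    by (simp add: restrict_def)
  have m: "(\<lambda>\<omega> i. Z i \<omega>) \<in> M \<rightarrow>\<^sub>M ?Q" "(\<lambda>z i. z (\<tau> i)) \<in> ?Q \<rightarrow>\<^sub>M ?Q"
    using rv by (auto intro!: measurable_PiM_single' simp: space_PiM PiE_iff dest: measurable_space)
  have "distr M ?Q (\<lambda>\<omega> i. Z (\<tau> i) \<omega>) = distr (distr M ?Q (\<lambda>\<omega> i. Z i \<omega>)) ?Q (\<lambda>z i. z (\<tau> i))"
    using distr_distr[OF m(2,1)] by (simp add: comp_def)
  \<comment> \<open>Only the target measure is replaced, by one with the same measurable sets, to
    match the form of the reindexing result for product measures.\<close>
  also have "\<dots> = distr (Pi\<^sub>M UNIV (\<lambda>_. ?\<nu>)) (Pi\<^sub>M UNIV (\<lambda>_. ?\<nu>)) (\<lambda>z i. z (\<tau> i))"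
    unfolding Z by (intro distr_cong refl sets_PiM_cong) simp_all
  also have "\<dots> = Pi\<^sub>M UNIV (\<lambda>_. ?\<nu>)"
    using distr_PiM_reindex[of UNIV "\<lambda>_. ?\<nu>" \<tau> UNIV] \<open>inj \<tau>\<close> rv
    by (simp add: prob_space_distr restrict_def)
  finally show ?thesis
    using Z by simp
qed

text \<open>In the expanded square, independence and the zero mean annihilate the cross terms, and
  \<open>n\<close> equal diagonal terms remain.\<close>

lemma expectation_square_sum_iid:
  fixes V :: "nat \<Rightarrow> 'a \<Rightarrow> real"
  assumes ind: "indep_vars (\<lambda>_. borel) V UNIV"
    and same: "\<And>i. distr M borel (V i) = distr M borel (V 0)"
    and sq: "integrable M (\<lambda>\<omega>. (V 0 \<omega>)\<^sup>2)" and mean: "expectation (V 0) = 0"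
  shows "expectation (\<lambda>\<omega>. (\<Sum>i=1..n. V i \<omega>)\<^sup>2) = real n * expectation (\<lambda>\<omega>. (V 0 \<omega>)\<^sup>2)"
proof -
  have rv[measurable]: "random_variable borel (V i)" for i
    using ind by (simp add: indep_vars_def2)
  have sq': "integrable M (\<lambda>\<omega>. (V i \<omega>)\<^sup>2)"
    and esq: "expectation (\<lambda>\<omega>. (V i \<omega>)\<^sup>2) = expectation (\<lambda>\<omega>. (V 0 \<omega>)\<^sup>2)" for i
    using expectation_cong_distr[OF same[of i] rv rv, of "\<lambda>x. x\<^sup>2"] sq by simp_all
  have int: "integrable M (V i)" for i
    by (rule square_integrable_imp_integrable[OF rv sq'])
  have e0: "expectation (V i) = 0" for i
    using expectation_cong_distr(1)[OF same[of i] rv rv, of "\<lambda>x. x"] mean by simp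
  have intm: "integrable M (\<lambda>\<omega>. V i \<omega> * V j \<omega>)" for i j
    by (rule integrable_mult_of_squares) (use sq' in auto)
  have cross: "expectation (\<lambda>\<omega>. V i \<omega> * V j \<omega>) =
      (if i = j then expectation (\<lambda>\<omega>. (V 0 \<omega>)\<^sup>2) else 0)" for i j
  proof (cases "i = j")
    case True
    then show ?thesis using esq[of j] by (simp add: power2_eq_square)
  next
    case False
    have "expectation (\<lambda>\<omega>. \<Prod>k\<in>{i, j}. V k \<omega>) = (\<Prod>k\<in>{i, j}. expectation (V k))"
      by (intro indep_vars_lebesgue_integral indep_vars_subset[OF ind]) (auto simp: int)
    then show ?thesis using False e0 by simp
  qed
  have "expectation (\<lambda>\<omega>. (\<Sum>i=1..n. V i \<omega>)\<^sup>2) =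
      (\<Sum>i=1..n. \<Sum>j=1..n. expectation (\<lambda>\<omega>. V i \<omega> * V j \<omega>))"
    by (simp add: power2_eq_square sum_product intm)
  also have "\<dots> = real n * expectation (\<lambda>\<omega>. (V 0 \<omega>)\<^sup>2)"
    by (simp add: cross)
  finally show ?thesis .
qed

text \<open>This is the nonnegativity of the variance of the absolute value of
  \<open>f\<close>.\<close>

lemma expectation_abs_le_sqrt:
  fixes f :: "'a \<Rightarrow> real"
  assumes [measurable]: "random_variable borel f" and sq: "integrable M (\<lambda>\<omega>. (f \<omega>)\<^sup>2)"
  shows "expectation (\<lambda>\<omega>. \<bar>f \<omega>\<bar>) \<le> sqrt (expectation (\<lambda>\<omega>. (f \<omega>)\<^sup>2))"
proof -
  have "integrable M (\<lambda>\<omega>. \<bar>f \<omega>\<bar>)"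
    using square_integrable_imp_integrable[OF assms] by simp
  then have "0 \<le> expectation (\<lambda>\<omega>. (f \<omega>)\<^sup>2) - (expectation (\<lambda>\<omega>. \<bar>f \<omega>\<bar>))\<^sup>2"
    using variance_eq[of "\<lambda>\<omega>. \<bar>f \<omega>\<bar>"] variance_positive[of "\<lambda>\<omega>. \<bar>f \<omega>\<bar>"] sq by simp
  then show ?thesis
    by (intro real_le_rsqrt) simp
qed

text \<open>At each outcome the truncation is exact once \<open>K\<close> exceeds the absolute value
  of \<open>W\<close>, and the difference never exceeds that value, so dominated convergence
  applies.\<close>

lemma truncation_L1:
  fixes W :: "'a \<Rightarrow> real"
  assumes int: "integrable M W"
  shows "(\<lambda>K. expectation (\<lambda>\<omega>. \<bar>W \<omega> - max (- real K) (min (real K) (W \<omega>))\<bar>)) \<longlonglongrightarrow> 0"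
proof -
  have [measurable]: "random_variable borel W"
    using int by simp
  have "(\<lambda>K. expectation (\<lambda>\<omega>. \<bar>W \<omega> - max (- real K) (min (real K) (W \<omega>))\<bar>))
      \<longlonglongrightarrow> expectation (\<lambda>\<omega>. 0)"
  proof (rule integral_dominated_convergence[where w = "\<lambda>\<omega>. \<bar>W \<omega>\<bar>"])
    have "(\<lambda>K. \<bar>x - max (- real K) (min (real K) x)\<bar>) \<longlonglongrightarrow> 0" for x
    proof (rule tendsto_eventually)
      have "\<forall>\<^sub>F K in sequentially. \<bar>x\<bar> \<le> real K"
        using filterlim_real_sequentially unfolding filterlim_at_top by blast
      then show "\<forall>\<^sub>F K in sequentially. \<bar>x - max (- real K) (min (real K) x)\<bar> = 0"
        by eventually_elim (auto simp: max_def min_def)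
    qed
    then show "AE \<omega> in M. (\<lambda>K. \<bar>W \<omega> - max (- real K) (min (real K) (W \<omega>))\<bar>) \<longlonglongrightarrow> 0"
      by simp
    show "AE \<omega> in M. norm \<bar>W \<omega> - max (- real K) (min (real K) (W \<omega>))\<bar> \<le> \<bar>W \<omega>\<bar>" for K
      by (auto simp: max_def min_def)
  qed (use int in auto)
  then show ?thesis by simp
qed

text \<open>
  Only a first moment is available, so the variables are truncated at \<open>K\<close>: the bounded part obeys
  the second moment bound \<open>2 * K / sqrt n\<close>, and the tail is small in \<open>L\<^sub>1\<close> uniformly in \<open>n\<close>.
\<close>

lemma iid_L1_law_of_large_numbers:
  fixes W :: "nat \<Rightarrow> 'a \<Rightarrow> real"
  assumes ind: "indep_vars (\<lambda>_. borel) W UNIV"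
    and same: "\<And>i. distr M borel (W i) = distr M borel (W 0)"
    and int0: "integrable M (W 0)"
  shows "(\<lambda>n. expectation (\<lambda>\<omega>. \<bar>(\<Sum>i=1..n. W i \<omega>) / real n - expectation (W 0)\<bar>)) \<longlonglongrightarrow> 0"
proof (rule LIMSEQ_I)
  fix \<delta> :: real assume "0 < \<delta>"
  have rv[measurable]: "random_variable borel (W i)" for i
    using ind by (simp add: indep_vars_def2)
  have int: "integrable M (W i)" for i
    using expectation_cong_distr(2)[OF same[of i] rv rv, of "\<lambda>x. x"] int0 by simp
  define \<mu> where "\<mu> = expectation (W 0)"
  define T :: "nat \<Rightarrow> real \<Rightarrow> real" where "T K x = max (- real K) (min (real K) x)" for K x
  have [measurable]: "T K \<in> borel_measurable borel" for K
    unfolding T_def[abs_def] by measurable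
  have T_le: "\<bar>T K x\<bar> \<le> real K" for K x
    by (auto simp: T_def)
  define \<tau> where "\<tau> K = expectation (\<lambda>\<omega>. \<bar>W 0 \<omega> - T K (W 0 \<omega>)\<bar>)" for K
  have "\<tau> \<longlonglongrightarrow> 0"
    using truncation_L1[OF int0] by (simp add: \<tau>_def[abs_def] T_def)
  then have "\<forall>\<^sub>F K in sequentially. \<tau> K < \<delta> / 4"
    using \<open>0 < \<delta>\<close> by (intro order_tendstoD) auto
  \<comment> \<open>The tail enters twice, through the sample mean and through the shift of the
    expectation. A quarter for each leaves half of \<open>\<delta>\<close> for the bounded
    part.\<close>
  then obtain K where K: "\<tau> K < \<delta> / 4"
    by (auto simp: eventually_sequentially)
  define c where "c = expectation (\<lambda>\<omega>. T K (W 0 \<omega>))"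
  define V where "V i \<omega> = T K (W i \<omega>) - c" for i \<omega>
  have [measurable]: "random_variable borel (V i)" for i
    unfolding V_def[abs_def] by measurable
  have intT: "integrable M (\<lambda>\<omega>. T K (W i \<omega>))" for i
    by (rule integrable_const_bound[of _ "real K"]) (auto simp: T_le)
  have "\<bar>c\<bar> \<le> real K"
  proof -
    have "\<bar>c\<bar> \<le> expectation (\<lambda>\<omega>. \<bar>T K (W 0 \<omega>)\<bar>)"
      unfolding c_def by (rule integral_abs_bound)
    also have "\<dots> \<le> expectation (\<lambda>_. real K)"
      using intT[of 0] by (intro integral_mono) (auto simp: T_le)
    finally show ?thesis by (simp add: prob_space)
  qed
  have V_le: "(V i \<omega>)\<^sup>2 \<le> (2 * real K)\<^sup>2" for i \<omega>
    unfolding V_def using T_le[of K "W i \<omega>"] \<open>\<bar>c\<bar> \<le> real K\<close>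
    by (intro power2_le_iff_abs_le[THEN iffD2]) auto
  have sqV: "integrable M (\<lambda>\<omega>. (V i \<omega>)\<^sup>2)" for i
    by (rule integrable_const_bound[of _ "(2 * real K)\<^sup>2"]) (use V_le in auto)
  have indV: "indep_vars (\<lambda>_. borel) V UNIV"
    unfolding V_def[abs_def]
    by (rule indep_vars_compose2[OF ind, where Y = "\<lambda>_ x. T K x - c"]) measurable
  have sameV: "distr M borel (V i) = distr M borel (V 0)" for i
  proof -
    have "distr M borel (V j) = distr (distr M borel (W j)) borel (\<lambda>x. T K x - c)" for j
      by (subst distr_distr) (simp_all add: comp_def V_def[abs_def])
    then show ?thesis using same[of i] by simp
  qed
  have "expectation (V 0) = 0"
    using intT[of 0] by (simp add: V_def[abs_def] c_def prob_space)
  then have E2: "expectation (\<lambda>\<omega>. (\<Sum>i=1..n. V i \<omega>)\<^sup>2) \<le> real n * (2 * real K)\<^sup>2" for n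
    using integral_mono[OF sqV[of 0], of "\<lambda>_. (2 * real K)\<^sup>2"] V_le
    by (subst expectation_square_sum_iid[OF indV sameV sqV]) (auto simp: prob_space intro!: mult_left_mono)
  have E1: "expectation (\<lambda>\<omega>. \<bar>(\<Sum>i=1..n. V i \<omega>) / real n\<bar>) \<le> 2 * real K / sqrt (real n)" for n
  proof -
    have "expectation (\<lambda>\<omega>. \<bar>\<Sum>i=1..n. V i \<omega>\<bar>) \<le> sqrt (real n * (2 * real K)\<^sup>2)"
      using sqV by (intro order.trans[OF expectation_abs_le_sqrt] real_sqrt_le_mono E2
          integrable_square_sum) auto
    also have "\<dots> = sqrt (real n) * (2 * real K)"
      by (simp add: real_sqrt_mult)
    finally have "expectation (\<lambda>\<omega>. \<bar>\<Sum>i=1..n. V i \<omega>\<bar>) / real n \<le>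
        sqrt (real n) * (2 * real K) / real n"
      by (intro divide_right_mono) auto
    also have "\<dots> = 2 * real K / sqrt (real n)"
      by (cases "n = 0") (simp_all add: field_simps flip: real_sqrt_mult)
    finally show ?thesis by (simp add: abs_divide)
  qed
  have tail: "expectation (\<lambda>\<omega>. \<bar>W i \<omega> - T K (W i \<omega>)\<bar>) = \<tau> K" for i
    unfolding \<tau>_def
    by (rule expectation_cong_distr(1)[OF same rv rv, of "\<lambda>x. \<bar>x - T K x\<bar>"]) measurable
  \<comment> \<open>Centring at \<open>c\<close> gives \<open>V\<close> mean zero; returning to
    \<open>\<mu>\<close> costs no more than the tail.\<close>
  have "\<bar>\<mu> - c\<bar> \<le> \<tau> K"
  proof -
    have "\<mu> - c = expectation (\<lambda>\<omega>. W 0 \<omega> - T K (W 0 \<omega>))"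
      unfolding \<mu>_def c_def using int0 intT by simp
    then show ?thesis
      unfolding \<tau>_def using integral_abs_bound[of M "\<lambda>\<omega>. W 0 \<omega> - T K (W 0 \<omega>)"] by simp
  qed
  have intV: "integrable M (V i)" for i
    using intT by (simp add: V_def[abs_def])
  have bound: "expectation (\<lambda>\<omega>. \<bar>(\<Sum>i=1..n. W i \<omega>) / real n - \<mu>\<bar>) \<le>
      2 * real K / sqrt (real n) + 2 * \<tau> K" if "0 < n" for n
  proof -
    have pt: "\<bar>(\<Sum>i=1..n. W i \<omega>) / real n - \<mu>\<bar> \<le> \<bar>(\<Sum>i=1..n. V i \<omega>) / real n\<bar> +
        (\<Sum>i=1..n. \<bar>W i \<omega> - T K (W i \<omega>)\<bar>) / real n + \<tau> K" for \<omega>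
    proof -
      have "(\<Sum>i=1..n. W i \<omega>) = (\<Sum>i=1..n. V i \<omega>) + (\<Sum>i=1..n. W i \<omega> - T K (W i \<omega>)) + real n * c"
        by (simp add: V_def sum.distrib sum_subtractf)
      then have "(\<Sum>i=1..n. W i \<omega>) / real n - \<mu> = (\<Sum>i=1..n. V i \<omega>) / real n +
          (\<Sum>i=1..n. W i \<omega> - T K (W i \<omega>)) / real n + (c - \<mu>)"
        using that by (simp add: add_divide_distrib)
      moreover have "\<bar>(\<Sum>i=1..n. W i \<omega> - T K (W i \<omega>)) / real n\<bar> \<le>
          (\<Sum>i=1..n. \<bar>W i \<omega> - T K (W i \<omega>)\<bar>) / real n"
        by (simp add: abs_divide divide_right_mono sum_abs)
      ultimately show ?thesis
        using \<open>\<bar>\<mu> - c\<bar> \<le> \<tau> K\<close> by linarith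
    qed
    have "expectation (\<lambda>\<omega>. \<bar>(\<Sum>i=1..n. W i \<omega>) / real n - \<mu>\<bar>) \<le>
        expectation (\<lambda>\<omega>. \<bar>(\<Sum>i=1..n. V i \<omega>) / real n\<bar> +
        (\<Sum>i=1..n. \<bar>W i \<omega> - T K (W i \<omega>)\<bar>) / real n + \<tau> K)"
      using int intV intT by (intro integral_mono pt) auto
    also have "\<dots> = expectation (\<lambda>\<omega>. \<bar>(\<Sum>i=1..n. V i \<omega>) / real n\<bar>) +
        (\<Sum>i=1..n. expectation (\<lambda>\<omega>. \<bar>W i \<omega> - T K (W i \<omega>)\<bar>)) / real n + \<tau> K"
      using int intV intT by (simp add: prob_space)
    also have "\<dots> \<le> 2 * real K / sqrt (real n) + 2 * \<tau> K"
      using E1[of n] that by (simp add: tail)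
    finally show ?thesis .
  qed
  have "(\<lambda>n. 2 * real K / sqrt (real n)) \<longlonglongrightarrow> 0"
    by real_asymp
  then have "\<forall>\<^sub>F n in sequentially. 2 * real K / sqrt (real n) < \<delta> / 2"
    using \<open>0 < \<delta>\<close> by (intro order_tendstoD) auto
  then have "\<forall>\<^sub>F n in sequentially. expectation (\<lambda>\<omega>. \<bar>(\<Sum>i=1..n. W i \<omega>) / real n - \<mu>\<bar>) < \<delta>"
    using eventually_gt_at_top[of 0]
  proof eventually_elim
    case (elim n)
    then show ?case using bound[of n] K by linarith
  qed
  then show "\<exists>no. \<forall>n\<ge>no. norm (expectation (\<lambda>\<omega>. \<bar>(\<Sum>i=1..n. W i \<omega>) / real n -
      expectation (W 0)\<bar>) - 0) < \<delta>"
    by (auto simp: eventually_sequentially \<mu>_def)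
qed

end

subsection \<open>Perturbation of the empirical variance\<close>

text \<open>Taken for an arbitrary sequence, so that the same functional applies to the residuals
  and to the unobservable errors.\<close>

definition empirical_variance :: "nat \<Rightarrow> (nat \<Rightarrow> real) \<Rightarrow> real" where
  "empirical_variance n e = (\<Sum>i=1..n. (e i - (\<Sum>j=1..n. e j) / real n)\<^sup>2) / real n"

text \<open>The Steiner identity. It splits off the squared mean and also shows that centring never
  increases a sum of squares.\<close>

lemma sum_squares_centered:
  fixes e :: "nat \<Rightarrow> real"
  shows "(\<Sum>i=1..n. (e i - (\<Sum>j=1..n. e j) / real n)\<^sup>2) =
    (\<Sum>i=1..n. (e i)\<^sup>2) - (\<Sum>i=1..n. e i)\<^sup>2 / real n"
proof (cases "n = 0")
  case False
  define s where "s = (\<Sum>j=1..n. e j)"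
  have "(\<Sum>i=1..n. (e i - s / real n)\<^sup>2) = (\<Sum>i=1..n. (e i)\<^sup>2) - 2 * (s / real n) * s + real n * (s / real n)\<^sup>2"
    by (simp add: power2_diff sum.distrib sum_subtractf s_def sum_distrib_left sum_distrib_right
        sum_divide_distrib mult_ac)
  also have "\<dots> = (\<Sum>i=1..n. (e i)\<^sup>2) - s\<^sup>2 / real n"
    using False by (simp add: power2_eq_square field_simps)
  finally show ?thesis by (simp add: s_def)
qed simp

lemma empirical_variance_eq:
  "empirical_variance n e = (\<Sum>i=1..n. (e i)\<^sup>2) / real n - ((\<Sum>i=1..n. e i) / real n)\<^sup>2"
  unfolding empirical_variance_def sum_squares_centered
  by (simp add: diff_divide_distrib power_divide power2_eq_square)

text \<open>Centring is linear, so the centred difference is \<open>u i - v i\<close>. The change of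
  its square contains one cross term, which is split with weight \<open>\<delta>\<close>; a free
  \<open>\<delta>\<close> lets a small perturbation be balanced against errors that are merely
  bounded in mean square.\<close>

lemma empirical_variance_perturbation:
  fixes e r :: "nat \<Rightarrow> real"
  assumes "0 < \<delta>"
  shows "\<bar>empirical_variance n (\<lambda>i. e i - r i) - empirical_variance n e\<bar> \<le>
    (1 + 1 / \<delta>) * ((\<Sum>i=1..n. (r i)\<^sup>2) / real n) + \<delta> * ((\<Sum>i=1..n. (e i)\<^sup>2) / real n)"
proof -
  define u where "u i = e i - (\<Sum>j=1..n. e j) / real n" for i
  define v where "v i = r i - (\<Sum>j=1..n. r j) / real n" for i
  have uv: "e i - r i - (\<Sum>j=1..n. e j - r j) / real n = u i - v i" for i
    by (simp add: u_def v_def sum_subtractf diff_divide_distrib)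
  have pt: "\<bar>(u i - v i)\<^sup>2 - (u i)\<^sup>2\<bar> \<le> (1 + 1 / \<delta>) * (v i)\<^sup>2 + \<delta> * (u i)\<^sup>2" for i
  proof -
    \<comment> \<open>Young's inequality, obtained by expanding a square and dividing by
      \<open>\<delta>\<close>.\<close>
    have "0 \<le> (\<delta> * \<bar>u i\<bar> - \<bar>v i\<bar>)\<^sup>2 / \<delta>"
      using assms by simp
    also have "\<dots> = \<delta> * (u i)\<^sup>2 + (v i)\<^sup>2 / \<delta> - 2 * \<bar>u i * v i\<bar>"
      using assms by (simp add: power2_diff power_mult_distrib abs_mult field_simps power2_eq_square)
    finally have "2 * \<bar>u i * v i\<bar> \<le> \<delta> * (u i)\<^sup>2 + (v i)\<^sup>2 / \<delta>" by simp
    moreover have "(u i - v i)\<^sup>2 - (u i)\<^sup>2 = (v i)\<^sup>2 - 2 * (u i * v i)"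
      by (simp add: power2_diff)
    moreover have "\<bar>(v i)\<^sup>2 - 2 * (u i * v i)\<bar> \<le> (v i)\<^sup>2 + 2 * \<bar>u i * v i\<bar>"
      by (rule order.trans[OF abs_triangle_ineq4]) (simp add: abs_mult)
    ultimately show ?thesis by (simp add: distrib_right)
  qed
  have "\<bar>empirical_variance n (\<lambda>i. e i - r i) - empirical_variance n e\<bar> =
      \<bar>\<Sum>i=1..n. (u i - v i)\<^sup>2 - (u i)\<^sup>2\<bar> / real n"
    unfolding empirical_variance_def uv u_def[symmetric]
    by (simp add: sum_subtractf abs_divide flip: diff_divide_distrib)
  also have "\<dots> \<le> (\<Sum>i=1..n. (1 + 1 / \<delta>) * (v i)\<^sup>2 + \<delta> * (u i)\<^sup>2) / real n"
    by (intro divide_right_mono order.trans[OF sum_abs] sum_mono pt) simp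
  also have "\<dots> = (1 + 1 / \<delta>) * ((\<Sum>i=1..n. (v i)\<^sup>2) / real n) + \<delta> * ((\<Sum>i=1..n. (u i)\<^sup>2) / real n)"
    by (simp add: sum.distrib add_divide_distrib flip: sum_distrib_left)
  \<comment> \<open>Raw squares replace the centred ones, because the term subtracted in
    \<open>sum_squares_centered\<close> is nonnegative.\<close>
  also have "\<dots> \<le> (1 + 1 / \<delta>) * ((\<Sum>i=1..n. (r i)\<^sup>2) / real n) + \<delta> * ((\<Sum>i=1..n. (e i)\<^sup>2) / real n)"
    using assms unfolding u_def v_def sum_squares_centered
    by (intro add_mono mult_left_mono divide_right_mono) auto
  finally show ?thesis .
qed

section \<open>Mean convergence of empirical variances, exact and perturbed\<close>

context prob_space
begin

text \<open>The mean of the squares obeys the law of large numbers, which asks only for a second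
  moment of the errors. The squared mean that is subtracted has expectation \<open>s / n\<close>,
  since the second moment of the sum is \<open>n * s\<close>.\<close>

lemma empirical_variance_L1_consistent:
  fixes e :: "nat \<Rightarrow> 'a \<Rightarrow> real"
  assumes ind: "indep_vars (\<lambda>_. borel) e UNIV"
    and same: "\<And>i. distr M borel (e i) = distr M borel (e 0)"
    and sq0: "integrable M (\<lambda>\<omega>. (e 0 \<omega>)\<^sup>2)" and mean: "expectation (e 0) = 0"
  shows "(\<lambda>n. expectation (\<lambda>\<omega>. \<bar>empirical_variance n (\<lambda>i. e i \<omega>) -
      expectation (\<lambda>\<omega>. (e 0 \<omega>)\<^sup>2)\<bar>)) \<longlonglongrightarrow> 0"
proof -
  have rv[measurable]: "random_variable borel (e i)" for i
    using ind by (simp add: indep_vars_def2)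
  have sq: "integrable M (\<lambda>\<omega>. (e i \<omega>)\<^sup>2)" for i
    using expectation_cong_distr(2)[OF same[of i] rv rv, of "\<lambda>x. x\<^sup>2"] sq0 by simp
  define s where "s = expectation (\<lambda>\<omega>. (e 0 \<omega>)\<^sup>2)"
  have intS: "integrable M (\<lambda>\<omega>. (\<Sum>i=1..n. e i \<omega>)\<^sup>2)" for n
    by (intro integrable_square_sum sq rv) auto
  have "distr M borel (\<lambda>\<omega>. (e i \<omega>)\<^sup>2) = distr (distr M borel (e i)) borel (\<lambda>x. x\<^sup>2)" for i
    by (subst distr_distr) (simp_all add: comp_def)
  then have same2: "distr M borel (\<lambda>\<omega>. (e i \<omega>)\<^sup>2) = distr M borel (\<lambda>\<omega>. (e 0 \<omega>)\<^sup>2)" for i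
    using same[of i] by simp
  have "indep_vars (\<lambda>_. borel) (\<lambda>i \<omega>. (e i \<omega>)\<^sup>2) UNIV"
    by (rule indep_vars_compose2[OF ind, where Y = "\<lambda>_ x. x\<^sup>2"]) simp
  from iid_L1_law_of_large_numbers[OF this same2 sq0]
  have lln: "(\<lambda>n. expectation (\<lambda>\<omega>. \<bar>(\<Sum>i=1..n. (e i \<omega>)\<^sup>2) / real n - s\<bar>)) \<longlonglongrightarrow> 0"
    unfolding s_def .
  have "expectation (\<lambda>\<omega>. \<bar>empirical_variance n (\<lambda>i. e i \<omega>) - s\<bar>) \<le>
      expectation (\<lambda>\<omega>. \<bar>(\<Sum>i=1..n. (e i \<omega>)\<^sup>2) / real n - s\<bar>) + s / real n" for n
  proof -
    have "expectation (\<lambda>\<omega>. \<bar>empirical_variance n (\<lambda>i. e i \<omega>) - s\<bar>) \<le>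
        expectation (\<lambda>\<omega>. \<bar>(\<Sum>i=1..n. (e i \<omega>)\<^sup>2) / real n - s\<bar> + ((\<Sum>i=1..n. e i \<omega>) / real n)\<^sup>2)"
    proof (intro integral_mono)
      show "\<bar>empirical_variance n (\<lambda>i. e i \<omega>) - s\<bar> \<le>
          \<bar>(\<Sum>i=1..n. (e i \<omega>)\<^sup>2) / real n - s\<bar> + ((\<Sum>i=1..n. e i \<omega>) / real n)\<^sup>2" for \<omega>
        unfolding empirical_variance_eq
        using zero_le_power2[of "(\<Sum>i=1..n. e i \<omega>) / real n"] by linarith
    qed (use sq intS in \<open>auto simp: empirical_variance_eq power_divide\<close>)
    also have "\<dots> = expectation (\<lambda>\<omega>. \<bar>(\<Sum>i=1..n. (e i \<omega>)\<^sup>2) / real n - s\<bar>) +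
        (real n * s) / (real n)\<^sup>2"
      using sq intS expectation_square_sum_iid[OF ind same sq0 mean, of n]
      by (simp add: power_divide s_def)
    finally show ?thesis
      by (cases "n = 0") (simp_all add: power2_eq_square)
  qed
  note le = this
  show ?thesis
    unfolding s_def[symmetric]
  proof (rule real_tendsto_sandwich[OF _ _ tendsto_const])
    show "\<forall>\<^sub>F n in sequentially. expectation (\<lambda>\<omega>. \<bar>empirical_variance n (\<lambda>i. e i \<omega>) - s\<bar>) \<le>
        expectation (\<lambda>\<omega>. \<bar>(\<Sum>i=1..n. (e i \<omega>)\<^sup>2) / real n - s\<bar>) + s / real n"
      by (rule always_eventually, rule allI, rule le)
    show "(\<lambda>n. expectation (\<lambda>\<omega>. \<bar>(\<Sum>i=1..n. (e i \<omega>)\<^sup>2) / real n - s\<bar>) + s / real n)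
        \<longlonglongrightarrow> 0"
      using tendsto_add[OF lln lim_const_over_n[of s]] by simp
  qed simp
qed

text \<open>
  The perturbation bound is used with \<open>\<delta> = sqrt (\<rho> n) + 1 / n\<close>: large enough to control
  \<open>\<rho> n / \<delta>\<close>, yet vanishing, and positive also where \<open>\<rho> n = 0\<close>.
\<close>

lemma perturbed_empirical_variance_L1_consistent:
  fixes e :: "nat \<Rightarrow> 'a \<Rightarrow> real" and r :: "nat \<Rightarrow> nat \<Rightarrow> 'a \<Rightarrow> real"
  assumes ind: "indep_vars (\<lambda>_. borel) e UNIV"
    and same: "\<And>i. distr M borel (e i) = distr M borel (e 0)"
    and sq0: "integrable M (\<lambda>\<omega>. (e 0 \<omega>)\<^sup>2)" and mean: "expectation (e 0) = 0"
    and r: "\<And>n i. 2 \<le> n \<Longrightarrow> i \<in> {1..n} \<Longrightarrow> random_variable borel (r n i)"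
    and sqr: "\<And>n i. 2 \<le> n \<Longrightarrow> i \<in> {1..n} \<Longrightarrow> integrable M (\<lambda>\<omega>. (r n i \<omega>)\<^sup>2)"
    and \<rho>: "\<And>n i. 2 \<le> n \<Longrightarrow> i \<in> {1..n} \<Longrightarrow> expectation (\<lambda>\<omega>. (r n i \<omega>)\<^sup>2) = \<rho> n"
    and lim: "\<rho> \<longlonglongrightarrow> 0"
  shows "\<And>n. 2 \<le> n \<Longrightarrow>
      integrable M (\<lambda>\<omega>. empirical_variance n (\<lambda>i. e i \<omega> - r n i \<omega>))"
    and "(\<lambda>n. expectation (\<lambda>\<omega>. empirical_variance n (\<lambda>i. e i \<omega> - r n i \<omega>)))
      \<longlonglongrightarrow> expectation (\<lambda>\<omega>. (e 0 \<omega>)\<^sup>2)"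
    and "(\<lambda>n. expectation (\<lambda>\<omega>. \<bar>empirical_variance n (\<lambda>i. e i \<omega> - r n i \<omega>) -
      expectation (\<lambda>\<omega>. (e 0 \<omega>)\<^sup>2)\<bar>)) \<longlonglongrightarrow> 0"
proof -
  have rv[measurable]: "random_variable borel (e i)" for i
    using ind by (simp add: indep_vars_def2)
  define s where "s = expectation (\<lambda>\<omega>. (e 0 \<omega>)\<^sup>2)"
  have sq: "integrable M (\<lambda>\<omega>. (e i \<omega>)\<^sup>2)"
    and esq: "expectation (\<lambda>\<omega>. (e i \<omega>)\<^sup>2) = s" for i
    using expectation_cong_distr[OF same[of i] rv rv, of "\<lambda>x. x\<^sup>2"] sq0
    by (simp_all add: s_def)
  have int_ev: "integrable M (\<lambda>\<omega>. empirical_variance n (\<lambda>i. f i \<omega>))"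
    if "\<And>i. i \<in> {1..n} \<Longrightarrow> random_variable borel (f i)"
      "\<And>i. i \<in> {1..n} \<Longrightarrow> integrable M (\<lambda>\<omega>. (f i \<omega>)\<^sup>2)" for f :: "nat \<Rightarrow> 'a \<Rightarrow> real" and n
  proof -
    have "integrable M (\<lambda>\<omega>. (\<Sum>i=1..n. f i \<omega>)\<^sup>2)"
      by (intro integrable_square_sum that) auto
    then show ?thesis
      unfolding empirical_variance_eq power_divide using that
      by (intro Bochner_Integration.integrable_diff integrable_divide_zero
          Bochner_Integration.integrable_sum) auto
  qed
  show int: "integrable M (\<lambda>\<omega>. empirical_variance n (\<lambda>i. e i \<omega> - r n i \<omega>))" if "2 \<le> n" for n
  proof (rule int_ev)
    fix i assume i: "i \<in> {1..n}"
    note [measurable] = r[OF that i]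
    show "random_variable borel (\<lambda>\<omega>. e i \<omega> - r n i \<omega>)"
      by measurable
    show "integrable M (\<lambda>\<omega>. (e i \<omega> - r n i \<omega>)\<^sup>2)"
      using integrable_square_add[where f = "e i" and M = M and g = "\<lambda>\<omega>. - r n i \<omega>"] sq[of i] sqr[OF that i]
      by simp
  qed
  have int0: "integrable M (\<lambda>\<omega>. empirical_variance n (\<lambda>i. e i \<omega>))" for n
    by (intro int_ev rv sq)
  define \<delta> where "\<delta> n = sqrt (\<rho> n) + 1 / real n" for n
  have \<rho>0: "0 \<le> \<rho> n" if "2 \<le> n" for n
    using \<rho>[OF that, of 1] that by (simp flip: \<rho>[OF that, of 1])
  have bound: "expectation (\<lambda>\<omega>. \<bar>empirical_variance n (\<lambda>i. e i \<omega> - r n i \<omega>) - s\<bar>) \<le>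
      \<rho> n + sqrt (\<rho> n) + \<delta> n * s + expectation (\<lambda>\<omega>. \<bar>empirical_variance n (\<lambda>i. e i \<omega>) - s\<bar>)"
    if n: "2 \<le> n" for n
  proof -
    have "0 < \<delta> n"
      using \<rho>0[OF n] n by (auto simp: \<delta>_def intro!: add_nonneg_pos)
    let ?A = "\<lambda>\<omega>. (1 + 1 / \<delta> n) * ((\<Sum>i=1..n. (r n i \<omega>)\<^sup>2) / real n)"
    let ?B = "\<lambda>\<omega>. \<delta> n * ((\<Sum>i=1..n. (e i \<omega>)\<^sup>2) / real n)"
    let ?C = "\<lambda>\<omega>. \<bar>empirical_variance n (\<lambda>i. e i \<omega>) - s\<bar>"
    have A: "integrable M ?A"
      by (intro integrable_mult_right integrable_divide_zero
          Bochner_Integration.integrable_sum sqr[OF n])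
    have B: "integrable M ?B" and C: "integrable M ?C"
      using sq int0 by auto
    have "expectation (\<lambda>\<omega>. \<bar>empirical_variance n (\<lambda>i. e i \<omega> - r n i \<omega>) - s\<bar>) \<le>
        expectation (\<lambda>\<omega>. ?A \<omega> + ?B \<omega> + ?C \<omega>)"
    proof (intro integral_mono)
      show "integrable M (\<lambda>\<omega>. \<bar>empirical_variance n (\<lambda>i. e i \<omega> - r n i \<omega>) - s\<bar>)"
        using int[OF n] by simp
      show "integrable M (\<lambda>\<omega>. ?A \<omega> + ?B \<omega> + ?C \<omega>)"
        using A B C by (intro Bochner_Integration.integrable_add)
      show "\<bar>empirical_variance n (\<lambda>i. e i \<omega> - r n i \<omega>) - s\<bar> \<le> ?A \<omega> + ?B \<omega> + ?C \<omega>" for \<omega>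
        using empirical_variance_perturbation[OF \<open>0 < \<delta> n\<close>, of n "\<lambda>i. e i \<omega>" "\<lambda>i. r n i \<omega>"]
        by linarith
    qed
    also have "\<dots> = expectation ?A + expectation ?B + expectation ?C"
      using A B C by simp
    also have "expectation ?A = (1 + 1 / \<delta> n) * \<rho> n"
      using sqr[OF n] \<rho>[OF n] n by simp
    also have "expectation ?B = \<delta> n * s"
      using sq esq n by simp
    \<comment> \<open>Since \<open>\<delta> n\<close> is at least \<open>sqrt (\<rho> n)\<close>,
      the quotient of \<open>\<rho> n\<close> by \<open>\<delta> n\<close> is at most
      \<open>sqrt (\<rho> n)\<close>.\<close>
    also have "(1 + 1 / \<delta> n) * \<rho> n \<le> \<rho> n + sqrt (\<rho> n)"
    proof -
      have "\<rho> n = sqrt (\<rho> n) * sqrt (\<rho> n)"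
        using \<rho>0[OF n] by simp
      also have "\<dots> \<le> sqrt (\<rho> n) * \<delta> n"
        using \<rho>0[OF n] by (intro mult_left_mono) (auto simp: \<delta>_def)
      finally show ?thesis
        using \<open>0 < \<delta> n\<close> by (simp add: distrib_right divide_le_eq)
    qed
    finally show ?thesis by simp
  qed
  have "(\<lambda>n. \<rho> n + sqrt (\<rho> n) + \<delta> n * s +
      expectation (\<lambda>\<omega>. \<bar>empirical_variance n (\<lambda>i. e i \<omega>) - s\<bar>)) \<longlonglongrightarrow>
      0 + sqrt 0 + (sqrt 0 + 0) * s + 0"
    unfolding \<delta>_def s_def
    by (intro tendsto_intros lim lim_const_over_n
        empirical_variance_L1_consistent[OF ind same sq0 mean])
  then have upper: "(\<lambda>n. \<rho> n + sqrt (\<rho> n) + \<delta> n * s +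
      expectation (\<lambda>\<omega>. \<bar>empirical_variance n (\<lambda>i. e i \<omega>) - s\<bar>)) \<longlonglongrightarrow> 0"
    by simp
  have L1: "(\<lambda>n. expectation (\<lambda>\<omega>. \<bar>empirical_variance n (\<lambda>i. e i \<omega> - r n i \<omega>) - s\<bar>))
      \<longlonglongrightarrow> 0"
  proof (rule real_tendsto_sandwich[OF _ _ tendsto_const])
    show "\<forall>\<^sub>F n in sequentially.
        expectation (\<lambda>\<omega>. \<bar>empirical_variance n (\<lambda>i. e i \<omega> - r n i \<omega>) - s\<bar>) \<le>
        \<rho> n + sqrt (\<rho> n) + \<delta> n * s +
          expectation (\<lambda>\<omega>. \<bar>empirical_variance n (\<lambda>i. e i \<omega>) - s\<bar>)"
      using eventually_ge_at_top[of 2] by eventually_elim (rule bound)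
  qed (use upper in simp_all)
  then show "(\<lambda>n. expectation (\<lambda>\<omega>. \<bar>empirical_variance n (\<lambda>i. e i \<omega> - r n i \<omega>) -
      expectation (\<lambda>\<omega>. (e 0 \<omega>)\<^sup>2)\<bar>)) \<longlonglongrightarrow> 0"
    by (simp add: s_def)
  have "\<forall>\<^sub>F n in sequentially.
      norm (expectation (\<lambda>\<omega>. empirical_variance n (\<lambda>i. e i \<omega> - r n i \<omega>)) - s) \<le>
      expectation (\<lambda>\<omega>. \<bar>empirical_variance n (\<lambda>i. e i \<omega> - r n i \<omega>) - s\<bar>)"
    using eventually_ge_at_top[of 2]
  proof eventually_elim
    case (elim n)
    \<comment> \<open>Integrability lets the constant move inside, so the bias is at most the mean
      absolute error.\<close>
    have "expectation (\<lambda>\<omega>. empirical_variance n (\<lambda>i. e i \<omega> - r n i \<omega>)) - s =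
        expectation (\<lambda>\<omega>. empirical_variance n (\<lambda>i. e i \<omega> - r n i \<omega>) - s)"
      using int[OF elim] by (simp add: prob_space)
    then show ?case
      by (simp add: integral_abs_bound)
  qed
  from Lim_null_comparison[OF this L1] show "(\<lambda>n. expectation (\<lambda>\<omega>.
      empirical_variance n (\<lambda>i. e i \<omega> - r n i \<omega>))) \<longlonglongrightarrow> expectation (\<lambda>\<omega>. (e 0 \<omega>)\<^sup>2)"
    unfolding s_def by (rule LIM_zero_cancel)
qed

end

subsection \<open>Consistency of the out-of-bag variance estimate\<close>

lemma sigma2_RF_eq_empirical_variance:
  "sigma2_RF mtry S rule a t n D =
    empirical_variance n (oob_residual mtry S rule a t n D)"
  by (simp add: sigma2_RF_def empirical_variance_def Let_def)

theorem theorem1: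
  fixes M :: "'w measure"
    and X :: "nat \<Rightarrow> 'w \<Rightarrow> real^'p::finite"
    and Y :: "nat \<Rightarrow> 'w \<Rightarrow> real"
    and \<epsilon> :: "'w \<Rightarrow> real"
    and m :: "real^'p \<Rightarrow> real"
    and \<sigma> :: real
    and mtry :: nat
    and a t :: "nat \<Rightarrow> nat"
    and S :: resampling
    and rule :: "'p cut_rule"
  assumes "prob_space M"
    and "1 \<le> mtry" and "mtry \<le> CARD('p)"
    and "\<And>n. 1 \<le> n \<Longrightarrow> 1 \<le> a n \<and> a n \<le> n"
    and "\<And>n. 1 \<le> n \<Longrightarrow> 1 \<le> t n \<and> t n \<le> a n"
    and "measurable_cut_rule rule"
    and "prob_space.indep_vars M (\<lambda>_. borel) (\<lambda>i \<omega>. (X i \<omega>, Y i \<omega>)) UNIV"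
    and "\<And>i. distr M borel (\<lambda>\<omega>. (X i \<omega>, Y i \<omega>)) = distr M borel (\<lambda>\<omega>. (X 0 \<omega>, Y 0 \<omega>))"
    and "\<And>i j \<omega>. \<omega> \<in> space M \<Longrightarrow> 0 \<le> X i \<omega> $ j \<and> X i \<omega> $ j \<le> 1"
    and "\<And>\<omega>. \<omega> \<in> space M \<Longrightarrow> Y 0 \<omega> = m (X 0 \<omega>) + \<epsilon> \<omega>"
    and "m \<in> borel_measurable borel"
    and "integrable M (\<lambda>\<omega>. \<bar>m (X 0 \<omega>)\<bar>\<^sup>2)"
    and "indep_random_variables M borel \<epsilon> borel (X 0)"
    and "integrable M \<epsilon>" and "prob_space.expectation M \<epsilon> = 0"
    and "integrable M (\<lambda>\<omega>. (\<epsilon> \<omega>)\<^sup>2)" and "prob_space.variance M \<epsilon> = \<sigma>\<^sup>2"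
    and "(\<lambda>n. prob_space.expectation M
            (\<lambda>\<omega>. (forest_estimate mtry S rule a t n (sample X Y \<omega>) (X 0 \<omega>) - m (X 0 \<omega>))\<^sup>2))
         \<longlonglongrightarrow> 0"
  shows "(\<forall>n\<ge>2. integrable M (\<lambda>\<omega>. sigma2_RF mtry S rule a t n (sample X Y \<omega>))) \<and>
         (\<lambda>n. prob_space.expectation M (\<lambda>\<omega>. sigma2_RF mtry S rule a t n (sample X Y \<omega>)))
           \<longlonglongrightarrow> \<sigma>\<^sup>2 \<and>
         (\<lambda>n. prob_space.expectation M (\<lambda>\<omega>. \<bar>sigma2_RF mtry S rule a t n (sample X Y \<omega>) - \<sigma>\<^sup>2\<bar>))
           \<longlonglongrightarrow> 0"
proof -
  interpret prob_space M by fact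
  define f where "f n D x = forest_estimate mtry S rule a t n D x" for n D x
  define Z where "Z i \<omega> = (X i \<omega>, Y i \<omega>)" for i \<omega>
  define e where "e i \<omega> = Y i \<omega> - m (X i \<omega>)" for i \<omega>
  \<comment> \<open>One functional of a whole sequence: the error at the location with index 0 of
    the forest built from the entries 1 to \<open>n - 1\<close>. Test error and out-of-bag errors
    are its values at differently indexed sequences.\<close>
  define h where "h n z = f (n - 1) z (fst (z 0)) - m (fst (z 0))" for n and z :: "nat \<Rightarrow> 'p point"
  define \<rho> where "\<rho> n = expectation (\<lambda>\<omega>. (h n (sample X Y \<omega>))\<^sup>2)" for n
  \<comment> \<open>Index 0 receives observation \<open>i\<close>; from 1 on, the remaining
    observations are enumerated in order, as in \<open>leave_out\<close>.\<close>
  define \<tau> :: "nat \<Rightarrow> nat \<Rightarrow> nat"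
    where "\<tau> i k = (if k = 0 then i else if k < i then k else Suc k)" for i k
  define r where "r n i \<omega> = h n (\<lambda>k. Z (\<tau> i k) \<omega>)" for n i \<omega>
  note mtry = \<open>mtry \<le> CARD('p)\<close> and mb[measurable] = \<open>m \<in> borel_measurable borel\<close>
  have a: "a n \<le> n" if "1 \<le> n" for n
    using assms(4)[OF that] by simp
  have Z_sample: "(\<lambda>k. Z k \<omega>) = sample X Y \<omega>" for \<omega>
    by (simp add: Z_def sample_def fun_eq_iff)
  have indZ: "indep_vars (\<lambda>_. borel) Z UNIV"
    using assms(7) by (simp add: Z_def[abs_def])
  have sameZ: "distr M borel (Z i) = distr M borel (Z 0)" for i
    unfolding Z_def[abs_def] by (rule assms(8))
  have rvZ: "random_variable borel (Z i)" for i
    using indZ by (simp add: indep_vars_def2)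
  have rvX[measurable]: "random_variable borel (X i)"
    and rvY[measurable]: "random_variable borel (Y i)" for i
    using measurable_fst_borel[OF rvZ[of i]] measurable_snd_borel[OF rvZ[of i]]
    by (simp_all add: Z_def)
  have fst_b: "(fst :: 'p point \<Rightarrow> _) \<in> borel_measurable borel"
    and snd_b: "(snd :: 'p point \<Rightarrow> _) \<in> borel_measurable borel"
    using measurable_fst_borel[OF measurable_ident, where 'b = "real^'p" and 'c = real]
      measurable_snd_borel[OF measurable_ident, where 'b = "real^'p" and 'c = real]
    by simp_all
  have res_b: "(\<lambda>z :: 'p point. snd z - m (fst z)) \<in> borel_measurable borel"
    by (intro borel_measurable_diff snd_b measurable_compose[OF fst_b mb])
  have ind_e: "indep_vars (\<lambda>_. borel) e UNIV"
    using indep_vars_compose2[OF indZ, of "\<lambda>_ z. snd z - m (fst z)" "\<lambda>_. borel"] res_b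
    by (simp add: Z_def e_def[abs_def])
  have same_e: "distr M borel (e i) = distr M borel (e 0)" for i
  proof -
    have "distr M borel (e j) = distr (distr M borel (Z j)) borel (\<lambda>z. snd z - m (fst z))" for j
      using distr_distr[OF res_b rvZ[of j]] by (simp add: comp_def Z_def e_def[abs_def])
    then show ?thesis using sameZ[of i] by simp
  qed
  \<comment> \<open>The model equation concerns the generic pair only; the other errors inherit
    their moments through equality in law.\<close>
  have e0: "e 0 \<omega> = \<epsilon> \<omega>" if "\<omega> \<in> space M" for \<omega>
    using assms(10)[OF that] by (simp add: e_def)
  have sq_e0: "integrable M (\<lambda>\<omega>. (e 0 \<omega>)\<^sup>2)"
    using Bochner_Integration.integrable_cong[of M M "\<lambda>\<omega>. (e 0 \<omega>)\<^sup>2" "\<lambda>\<omega>. (\<epsilon> \<omega>)\<^sup>2"]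
      e0 assms(16) by simp
  have mean_e0: "expectation (e 0) = 0"
    using Bochner_Integration.integral_cong[of M M "e 0" \<epsilon>] e0 assms(15) by simp
  have var_e0: "expectation (\<lambda>\<omega>. (e 0 \<omega>)\<^sup>2) = \<sigma>\<^sup>2"
    using Bochner_Integration.integral_cong[of M M "\<lambda>\<omega>. (e 0 \<omega>)\<^sup>2" "\<lambda>\<omega>. (\<epsilon> \<omega>)\<^sup>2"]
      e0 assms(15,17) by simp
  have sq_m: "integrable M (\<lambda>\<omega>. (m (X 0 \<omega>))\<^sup>2)"
    using assms(12) by simp
  have sq_Y: "integrable M (\<lambda>\<omega>. (Y i \<omega>)\<^sup>2)" for i
  proof -
    have "integrable M (\<lambda>\<omega>. (m (X 0 \<omega>) + e 0 \<omega>)\<^sup>2)"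
      by (rule integrable_square_add) (use sq_m sq_e0 in \<open>auto simp: e_def[abs_def]\<close>)
    then have "integrable M (\<lambda>\<omega>. (Y 0 \<omega>)\<^sup>2)"
      by (simp add: e_def)
    then show ?thesis
      using expectation_cong_distr(2)[OF sameZ rvZ rvZ borel_measurable_power[OF snd_b], of i 2]
      by (simp add: Z_def)
  qed
  have f_b: "(\<lambda>\<omega>. f n (sample X Y \<omega>) (X 0 \<omega>)) \<in> borel_measurable M" if "1 \<le> n" for n
    unfolding f_def using rvZ
    by (intro measurable_forest_estimate that a mtry assms(6) rvX)
      (simp add: sample_def Z_def[abs_def])
  \<comment> \<open>A nonexistent integral has the default value 0, so integrability cannot be read
    off from the limit of the risks. It is derived from the bound by the sum of the
    responses.\<close>
  have f_sq: "integrable M (\<lambda>\<omega>. (f n (sample X Y \<omega>) (X 0 \<omega>))\<^sup>2)" if "1 \<le> n" for n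
  proof (rule Bochner_Integration.integrable_bound)
    show "integrable M (\<lambda>\<omega>. (\<Sum>i=1..n. \<bar>Y i \<omega>\<bar>)\<^sup>2)"
      by (rule integrable_square_sum) (use sq_Y in auto)
    show "(\<lambda>\<omega>. (f n (sample X Y \<omega>) (X 0 \<omega>))\<^sup>2) \<in> borel_measurable M"
      using f_b[OF that] by measurable
    have "(f n (sample X Y \<omega>) (X 0 \<omega>))\<^sup>2 \<le> (\<Sum>i=1..n. \<bar>Y i \<omega>\<bar>)\<^sup>2" for \<omega>
      using abs_forest_estimate_le[of n a mtry S rule t "sample X Y \<omega>" "X 0 \<omega>", OF that a[OF that] mtry]
      by (intro abs_le_square_iff[THEN iffD1]) (simp add: f_def sample_def)
    then show "AE \<omega> in M. norm ((f n (sample X Y \<omega>) (X 0 \<omega>))\<^sup>2) \<le>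
        norm ((\<Sum>i=1..n. \<bar>Y i \<omega>\<bar>)\<^sup>2)"
      by simp
  qed
  have h_sample: "h n (sample X Y \<omega>) = f (n - 1) (sample X Y \<omega>) (X 0 \<omega>) - m (X 0 \<omega>)" for n \<omega>
    by (simp add: h_def sample_def)
  have h_sq: "integrable M (\<lambda>\<omega>. (h n (sample X Y \<omega>))\<^sup>2)" if "2 \<le> n" for n
    using integrable_square_add[OF f_b, of "n - 1" "\<lambda>\<omega>. - m (X 0 \<omega>)"] f_sq[of "n - 1"] sq_m that
    by (simp add: h_sample)
  let ?Q = "Pi\<^sub>M UNIV (\<lambda>_ :: nat. borel :: 'p point measure)"
  \<comment> \<open>Transfer by equality in law requires measurability on the sequence space, not
    only along the sample.\<close>
  have h_b: "h n \<in> borel_measurable ?Q" if "2 \<le> n" for n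
  proof -
    have co: "(\<lambda>z. z k) \<in> ?Q \<rightarrow>\<^sub>M borel" for k
      by (rule measurable_component_singleton) simp
    have "(\<lambda>z. f (n - 1) z (fst (z 0))) \<in> borel_measurable ?Q"
      unfolding f_def using that
      by (intro measurable_forest_estimate a mtry assms(6) co measurable_compose[OF co fst_b]) auto
    then show ?thesis
      unfolding h_def[abs_def]
      by (intro borel_measurable_diff measurable_compose[OF measurable_compose[OF co fst_b] mb])
  qed
  have inj: "inj (\<tau> i)" if "1 \<le> i" for i
    using that by (auto simp: inj_def \<tau>_def split: if_splits)
  have seq_b: "(\<lambda>\<omega> k. Z (\<tau>' k) \<omega>) \<in> M \<rightarrow>\<^sub>M ?Q" for \<tau>' :: "nat \<Rightarrow> nat"
    using rvZ by (intro measurable_PiM_single') auto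
  have r_b: "random_variable borel (r n i)" if "2 \<le> n" for n i
    using measurable_compose[OF seq_b h_b[OF that]] by (simp add: r_def[abs_def])
  have hsq_b: "(\<lambda>z. (h n z)\<^sup>2) \<in> borel_measurable ?Q" if "2 \<le> n" for n
    using h_b[OF that] by measurable
  \<comment> \<open>The sequences indexed by \<open>\<tau> i\<close> and by the identity have the
    same law, so every out-of-bag error has the second moment of the test error with
    \<open>n - 1\<close> observations.\<close>
  have r_sq: "integrable M (\<lambda>\<omega>. (r n i \<omega>)\<^sup>2)"
    and r_\<rho>: "expectation (\<lambda>\<omega>. (r n i \<omega>)\<^sup>2) = \<rho> n" if "2 \<le> n" "i \<in> {1..n}" for n i
    using expectation_cong_distr[OF distr_iid_reindex[OF indZ sameZ inj] seq_b
        seq_b[of "\<lambda>k. k"] hsq_b, of i n] h_sq[of n] that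
    by (simp_all add: r_def \<rho>_def Z_sample)
  \<comment> \<open>The risk of the forest on \<open>n\<close> observations is
    \<open>\<rho> (Suc n)\<close>, as one observation is held out.\<close>
  have "(\<lambda>n. \<rho> (Suc n)) \<longlonglongrightarrow> 0"
    using assms(18) by (simp add: \<rho>_def h_sample f_def)
  then have \<rho>: "\<rho> \<longlonglongrightarrow> 0"
    by (rule LIMSEQ_imp_Suc)
  have residual: "oob_residual mtry S rule a t n (sample X Y \<omega>) i = e i \<omega> - r n i \<omega>"
    if "2 \<le> n" "i \<in> {1..n}" for n i \<omega>
  proof -
    \<comment> \<open>The two data sequences differ at index 0, where one keeps the generic pair and
      the other holds observation \<open>i\<close>; the forest reads only the indices from 1 to
      \<open>n - 1\<close>, where they agree.\<close>
    have "forest_estimate mtry S rule a t (n - 1) (leave_out i (sample X Y \<omega>)) (X i \<omega>) =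
        f (n - 1) (\<lambda>k. Z (\<tau> i k) \<omega>) (X i \<omega>)"
      unfolding f_def using that
      by (intro forest_estimate_cong a mtry)
        (auto simp: leave_out_def \<tau>_def sample_def Z_def)
    then show ?thesis
      by (simp add: oob_residual_def oob_prediction_def sample_def e_def r_def h_def \<tau>_def Z_def)
  qed
  have \<sigma>2: "sigma2_RF mtry S rule a t n (sample X Y \<omega>) =
      empirical_variance n (\<lambda>i. e i \<omega> - r n i \<omega>)" if "2 \<le> n" for n \<omega>
    unfolding sigma2_RF_eq_empirical_variance
    using residual[OF that] by (simp add: empirical_variance_def)
  note consistent = perturbed_empirical_variance_L1_consistent[where r = r and \<rho> = \<rho>,
      OF ind_e same_e sq_e0 mean_e0
      r_b r_sq r_\<rho> \<rho>, unfolded var_e0]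
  \<comment> \<open>The representation through \<open>e\<close> and \<open>r\<close> is available
    from \<open>n = 2\<close> on, which suffices for limits. The functional \<open>g\<close> is left
    free to serve both the expectation and the mean absolute error.\<close>
  have ev: "\<forall>\<^sub>F n in sequentially. g (\<lambda>\<omega>. empirical_variance n (\<lambda>i. e i \<omega> - r n i \<omega>)) =
      g (\<lambda>\<omega>. sigma2_RF mtry S rule a t n (sample X Y \<omega>))" for g :: "('w \<Rightarrow> real) \<Rightarrow> real"
    using eventually_ge_at_top[of 2] by eventually_elim (simp add: \<sigma>2)
  show ?thesis
    using consistent(1) \<sigma>2 Lim_transform_eventually[OF consistent(2) ev]
      Lim_transform_eventually[OF consistent(3) ev[of "\<lambda>u. expectation (\<lambda>\<omega>. \<bar>u \<omega> - \<sigma>\<^sup>2\<bar>)"]]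
    by simp
qed

end
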